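(* Let $\mathcal C$ be a braided monoidal category equipped with a class $\mathcal Q$ of regular epimorphisms satisfying the standing assumptions in the context. Let $(A,t_1,t_2,t_3,t_4,e)$ be a regular multiplier Hopf monoid in $\mathcal C$ whose multiplication $m=e1.t_1$ is non-degenerate and whose counit is dense ($e\in\mathcal Q$). Let $s\colon A^{\mathsf{op}}\nrightarrow A$ and $s'\colon A\nrightarrow A^{\mathsf{op}}$ be the antipodes, with components $$s_1=e1.t_1^{-1},\quad s_2=1e.t_2^{-1},\qquad s_1'=e1.t_3^{-1},\quad s_2'=1e.t_4^{-1}.$$ Then: (1) there is a unique morphism $\overline s\colon A\to A$ in $\mathcal C$ such that $s=\overline s^{\#}$, that is, $s_1=m.\overline s1$ and $s_2=m.1\overline s$; (2) there is a unique morphism $\overline s'\colon A\to A$ in $\mathcal C$ such that $s'=\overline s'^{\#}$ as an $\mathbb M$-morphism to $A^{\mathsf{op}}$, that is, $s'_1=m.c^{-1}.\overline s'1$ and $s'_2=m.c^{-1}.1\overline s'$; (3) $\overline s$ and $\overline s'$ are mutually inverse isomorphisms in $\mathcal C$.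
   Context: Notation: $\mathcal C$ is a braided monoidal category, written as if strict; the monoidal product (of objects and morphisms) is juxtaposition, the unit is $I$, the braiding is $c_{X,Y}\colon XY\to YX$. The composite of $f\colon A\to B$ and $g\colon B\to C$ is $g.f$ (juxtaposition binds more tightly than the dot); identity morphisms are written $1$; $A^n=A\cdots A$. Subscripts of $c$ are omitted; $c^{-1}\colon XY\to YX$ means $(c_{Y,X})^{-1}$. $\overline{\mathcal C}$ is the same monoidal category with the inverse braiding. Standing assumptions: $\mathcal Q$ is a class of regular epimorphisms in $\mathcal C$, closed under composition and monoidal product, containing the isomorphisms, right-cancellative ($s\in\mathcal Q$ and $t.s\in\mathcal Q$ imply $t\in\mathcal Q$), and such that each $q\in \mathcal Q$ is the coequalizer of some pair of morphisms for which this coequalizer is preserved by taking the monoidal product with any fixed object. Semigroups: a semigroup $(A,m)$ is an object with $m\colon A^2\to A$ satisfying $m.m1=m.1m$. It is non-degenerate if for all objects $X,Y$ the maps $\mathcal C(X,YA)\to\mathcal C(XA,YA)$, $f\mapsto 1m.f1$, and $\mathcal C(X,AY)\to\mathcal C(AX,AY)$, $g\mapsto m1.1g$, are injective. $A^{\mathsf{op}}$ denotes $(A,m.c^{-1})$. $\mathbb M$-morphisms: for a non-degenerate semigroup $(B,m)$ and an object $A$, an $\mathbb M$-morphism $f\colon A\nrightarrow B$ is a pair $f_1\colon AB\to B$, $f_2\colon BA\to B$ with $m.1f_1=m.f_21\colon BAB\to B$. For a morphism $z\colon Z\to A$ of $\mathcal C$ to a non-degenerate semigroup $(A,m)$, $z^\#\colon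 Z\nrightarrow A$ is the $\mathbb M$-morphism with components $m.z1$ and $m.1z$. Multiplier bimonoid in $\mathcal C$: $(A,t_1,t_2,e)$ with $t_1,t_2\colon A^2\to A^2$, $e\colon A\to I$ such that $t_11.c^{-1}1.1t_1.c1.1t_1=1t_1.t_11$ and $1e.t_1=1e$; $1t_2.1c^{-1}.t_21.1c.t_21=t_21.1t_2$ and $e1.t_2=e1$; $1t_1.t_21=t_21.1t_1$ and $e1.t_1=1e.t_2$. Its multiplication $m:=e1.t_1=1e.t_2$ is associative. A regular multiplier bimonoid in $\mathcal C$ is $(A,t_1,t_2,t_3,t_4,e)$ such that $(A,t_1,t_2,e)$ is a multiplier bimonoid in $\mathcal C$, $(A,t_3,t_4,e)$ is a multiplier bimonoid in $\overline{\mathcal C}$, and, with $m:=e1.t_1$: $e1.t_1=e1.t_3.c$; $1m.c1.1t_1=1m.t_31.c1$; $t_41.1t_1=1t_1.t_41$; $m1.1c.t_21=m1.1t_4.1c$; $1t_3.t_21=t_21.1t_3$. It is a regular multiplier Hopf monoid if moreover $t_1,t_2,t_3,t_4$ are all isomorphisms. *)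

theory Defs
  imports Main
begin

text \<open>
  Braided monoidal categories are not assumed strict: the associativity and unit constraints are part
  of the structure and appear explicitly wherever the usual ``strict'' notation suppresses them.
  Iterated products are bracketed to the left, so that $XYZ$ is read as $(XY)Z$.
\<close>

section \<open>Braided monoidal categories\<close>

record ('o, 'm) category_data =
  Ob :: "'o set"
  Ar :: "'m set"
  Dom :: "'m \<Rightarrow> 'o"
  Cod :: "'m \<Rightarrow> 'o"
  ident :: "'o \<Rightarrow> 'm"  (\<open>\<one>\<index>\<close>)
  comp :: "'m \<Rightarrow> 'm \<Rightarrow> 'm"  (infixr \<open>\<cdot>\<index>\<close> 55)

definition hom :: "('o, 'm, 'x) category_data_scheme \<Rightarrow> 'o \<Rightarrow> 'o \<Rightarrow> 'm set" where
  "hom C X Y = {f \<in> Ar C. Dom C f = X \<and> Cod C f = Y}"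

definition inverse_pair :: "('o, 'm, 'x) category_data_scheme \<Rightarrow> 'm \<Rightarrow> 'm \<Rightarrow> bool" where
  "inverse_pair C f g \<longleftrightarrow>
     f \<in> Ar C \<and> g \<in> hom C (Cod C f) (Dom C f) \<and>
     g \<cdot>\<^bsub>C\<^esub> f = \<one>\<^bsub>C\<^esub> (Dom C f) \<and> f \<cdot>\<^bsub>C\<^esub> g = \<one>\<^bsub>C\<^esub> (Cod C f)"

definition iso :: "('o, 'm, 'x) category_data_scheme \<Rightarrow> 'm \<Rightarrow> bool" where
  "iso C f \<longleftrightarrow> (\<exists>g. inverse_pair C f g)"

text \<open>Only meaningful when \<open>f\<close> is an isomorphism.\<close>

definition inv_mor :: "('o, 'm, 'x) category_data_scheme \<Rightarrow> 'm \<Rightarrow> 'm"  (\<open>minv\<index> _\<close> [81] 80) where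
  "inv_mor C f = (THE g. inverse_pair C f g)"

record ('o, 'm) monoidal_data = "('o, 'm) category_data" +
  tensor_ob :: "'o \<Rightarrow> 'o \<Rightarrow> 'o"  (infixl \<open>\<odot>\<index>\<close> 70)
  tensor :: "'m \<Rightarrow> 'm \<Rightarrow> 'm"  (infixl \<open>\<otimes>\<index>\<close> 70)
  unit_ob :: 'o  (\<open>\<I>\<index>\<close>)
  assoc :: "'o \<Rightarrow> 'o \<Rightarrow> 'o \<Rightarrow> 'm"  (\<open>\<alpha>\<index>\<close>)
  lunit :: "'o \<Rightarrow> 'm"  (\<open>\<l>\<index>\<close>)
  runit :: "'o \<Rightarrow> 'm"  (\<open>\<r>\<index>\<close>)

record ('o, 'm) braided_data = "('o, 'm) monoidal_data" +
  braid :: "'o \<Rightarrow> 'o \<Rightarrow> 'm"  (\<open>\<c>\<index>\<close>)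

locale category =
  fixes C (structure)
  assumes Dom_closed: "f \<in> Ar C \<Longrightarrow> Dom C f \<in> Ob C"
    and Cod_closed: "f \<in> Ar C \<Longrightarrow> Cod C f \<in> Ob C"
    and ident_closed: "X \<in> Ob C \<Longrightarrow> \<one> X \<in> hom C X X"
    and comp_closed: "\<lbrakk>f \<in> hom C X Y; g \<in> hom C Y Z\<rbrakk> \<Longrightarrow> g \<cdot> f \<in> hom C X Z"
    and comp_assoc: "\<lbrakk>f \<in> hom C W X; g \<in> hom C X Y; h \<in> hom C Y Z\<rbrakk> \<Longrightarrow> (h \<cdot> g) \<cdot> f = h \<cdot> (g \<cdot> f)"
    and comp_ident_left: "f \<in> hom C X Y \<Longrightarrow> \<one> Y \<cdot> f = f"
    and comp_ident_right: "f \<in> hom C X Y \<Longrightarrow> f \<cdot> \<one> X = f"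

locale monoidal_category = category +
  assumes unit_ob_closed: "\<I> \<in> Ob C"
    and tensor_ob_closed: "\<lbrakk>X \<in> Ob C; Y \<in> Ob C\<rbrakk> \<Longrightarrow> X \<odot> Y \<in> Ob C"
    and tensor_closed: "\<lbrakk>f \<in> hom C X X'; g \<in> hom C Y Y'\<rbrakk> \<Longrightarrow> f \<otimes> g \<in> hom C (X \<odot> Y) (X' \<odot> Y')"
    and tensor_ident: "\<lbrakk>X \<in> Ob C; Y \<in> Ob C\<rbrakk> \<Longrightarrow> \<one> X \<otimes> \<one> Y = \<one> (X \<odot> Y)"
    and interchange: "\<lbrakk>f \<in> hom C X X'; f' \<in> hom C X' X''; g \<in> hom C Y Y'; g' \<in> hom C Y' Y''\<rbrakk>
      \<Longrightarrow> (f' \<cdot> f) \<otimes> (g' \<cdot> g) = (f' \<otimes> g') \<cdot> (f \<otimes> g)"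
    and assoc_closed: "\<lbrakk>X \<in> Ob C; Y \<in> Ob C; Z \<in> Ob C\<rbrakk> \<Longrightarrow> \<alpha> X Y Z \<in> hom C ((X \<odot> Y) \<odot> Z) (X \<odot> (Y \<odot> Z))"
    and assoc_iso: "\<lbrakk>X \<in> Ob C; Y \<in> Ob C; Z \<in> Ob C\<rbrakk> \<Longrightarrow> iso C (\<alpha> X Y Z)"
    and assoc_natural: "\<lbrakk>f \<in> hom C X X'; g \<in> hom C Y Y'; h \<in> hom C Z Z'\<rbrakk>
      \<Longrightarrow> \<alpha> X' Y' Z' \<cdot> ((f \<otimes> g) \<otimes> h) = (f \<otimes> (g \<otimes> h)) \<cdot> \<alpha> X Y Z"
    and lunit_closed: "X \<in> Ob C \<Longrightarrow> \<l> X \<in> hom C (\<I> \<odot> X) X"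
    and lunit_iso: "X \<in> Ob C \<Longrightarrow> iso C (\<l> X)"
    and lunit_natural: "f \<in> hom C X Y \<Longrightarrow> \<l> Y \<cdot> (\<one> \<I> \<otimes> f) = f \<cdot> \<l> X"
    and runit_closed: "X \<in> Ob C \<Longrightarrow> \<r> X \<in> hom C (X \<odot> \<I>) X"
    and runit_iso: "X \<in> Ob C \<Longrightarrow> iso C (\<r> X)"
    and runit_natural: "f \<in> hom C X Y \<Longrightarrow> \<r> Y \<cdot> (f \<otimes> \<one> \<I>) = f \<cdot> \<r> X"
    and pentagon: "\<lbrakk>W \<in> Ob C; X \<in> Ob C; Y \<in> Ob C; Z \<in> Ob C\<rbrakk>
      \<Longrightarrow> (\<one> W \<otimes> \<alpha> X Y Z) \<cdot> \<alpha> W (X \<odot> Y) Z \<cdot> (\<alpha> W X Y \<otimes> \<one> Z) = \<alpha> W X (Y \<odot> Z) \<cdot> \<alpha> (W \<odot> X) Y Z"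
    and triangle: "\<lbrakk>X \<in> Ob C; Y \<in> Ob C\<rbrakk> \<Longrightarrow> (\<one> X \<otimes> \<l> Y) \<cdot> \<alpha> X \<I> Y = \<r> X \<otimes> \<one> Y"

locale braided_monoidal_category = monoidal_category +
  assumes braid_closed: "\<lbrakk>X \<in> Ob C; Y \<in> Ob C\<rbrakk> \<Longrightarrow> \<c> X Y \<in> hom C (X \<odot> Y) (Y \<odot> X)"
    and braid_iso: "\<lbrakk>X \<in> Ob C; Y \<in> Ob C\<rbrakk> \<Longrightarrow> iso C (\<c> X Y)"
    and braid_natural: "\<lbrakk>f \<in> hom C X X'; g \<in> hom C Y Y'\<rbrakk> \<Longrightarrow> \<c> X' Y' \<cdot> (f \<otimes> g) = (g \<otimes> f) \<cdot> \<c> X Y"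
    and hexagon1: "\<lbrakk>X \<in> Ob C; Y \<in> Ob C; Z \<in> Ob C\<rbrakk>
      \<Longrightarrow> \<alpha> Y Z X \<cdot> \<c> X (Y \<odot> Z) \<cdot> \<alpha> X Y Z = (\<one> Y \<otimes> \<c> X Z) \<cdot> \<alpha> Y X Z \<cdot> (\<c> X Y \<otimes> \<one> Z)"
    and hexagon2: "\<lbrakk>X \<in> Ob C; Y \<in> Ob C; Z \<in> Ob C\<rbrakk>
      \<Longrightarrow> minv (\<alpha> Z X Y) \<cdot> \<c> (X \<odot> Y) Z \<cdot> minv (\<alpha> X Y Z)
          = (\<c> X Z \<otimes> \<one> Y) \<cdot> minv (\<alpha> X Z Y) \<cdot> (\<one> X \<otimes> \<c> Y Z)"

text \<open>The inverse braiding $c^{-1} \colon XY \to YX$ is the inverse of $c_{Y,X}$.\<close>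

definition braid_inv :: "('o, 'm, 'x) braided_data_scheme \<Rightarrow> 'o \<Rightarrow> 'o \<Rightarrow> 'm"  (\<open>\<c>''\<index>\<close>) where
  "braid_inv C X Y = minv\<^bsub>C\<^esub> (\<c>\<^bsub>C\<^esub> Y X)"

definition inverse_braided :: "('o, 'm, 'x) braided_data_scheme \<Rightarrow> ('o, 'm, 'x) braided_data_scheme" where
  "inverse_braided C = C\<lparr>braid := braid_inv C\<rparr>"


section \<open>The class of regular epimorphisms\<close>

definition coequalizer :: "('o, 'm, 'x) category_data_scheme \<Rightarrow> 'm \<Rightarrow> 'm \<Rightarrow> 'm \<Rightarrow> bool" where
  "coequalizer C f g q \<longleftrightarrow>
     (\<exists>X Y Z. f \<in> hom C X Y \<and> g \<in> hom C X Y \<and> q \<in> hom C Y Z \<and> q \<cdot>\<^bsub>C\<^esub> f = q \<cdot>\<^bsub>C\<^esub> g \<and>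
        (\<forall>W. \<forall>h \<in> hom C Y W. h \<cdot>\<^bsub>C\<^esub> f = h \<cdot>\<^bsub>C\<^esub> g \<longrightarrow> (\<exists>!k. k \<in> hom C Z W \<and> k \<cdot>\<^bsub>C\<^esub> q = h)))"

definition regular_epi :: "('o, 'm, 'x) category_data_scheme \<Rightarrow> 'm \<Rightarrow> bool" where
  "regular_epi C q \<longleftrightarrow> (\<exists>f g. coequalizer C f g q)"

definition tensor_stable_coequalizer ::
  "('o, 'm, 'x) monoidal_data_scheme \<Rightarrow> 'm \<Rightarrow> 'm \<Rightarrow> 'm \<Rightarrow> bool" where
  "tensor_stable_coequalizer C f g q \<longleftrightarrow>
     coequalizer C f g q \<and>
     (\<forall>X \<in> Ob C.
        coequalizer C (\<one>\<^bsub>C\<^esub> X \<otimes>\<^bsub>C\<^esub> f) (\<one>\<^bsub>C\<^esub> X \<otimes>\<^bsub>C\<^esub> g) (\<one>\<^bsub>C\<^esub> X \<otimes>\<^bsub>C\<^esub> q) \<and>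
        coequalizer C (f \<otimes>\<^bsub>C\<^esub> \<one>\<^bsub>C\<^esub> X) (g \<otimes>\<^bsub>C\<^esub> \<one>\<^bsub>C\<^esub> X) (q \<otimes>\<^bsub>C\<^esub> \<one>\<^bsub>C\<^esub> X))"

locale regular_epi_class =
  fixes C (structure) and Q
  assumes regular_epi: "q \<in> Q \<Longrightarrow> regular_epi C q"
    and comp_mem: "\<lbrakk>s \<in> Q; t \<in> Q; s \<in> hom C X Y; t \<in> hom C Y Z\<rbrakk> \<Longrightarrow> t \<cdot> s \<in> Q"
    and tensor_mem: "\<lbrakk>s \<in> Q; t \<in> Q\<rbrakk> \<Longrightarrow> s \<otimes> t \<in> Q"
    and iso_mem: "iso C f \<Longrightarrow> f \<in> Q"
    and right_cancel: "\<lbrakk>s \<in> Q; t \<cdot> s \<in> Q; s \<in> hom C X Y; t \<in> hom C Y Z\<rbrakk> \<Longrightarrow> t \<in> Q"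
    and stable_coequalizer: "q \<in> Q \<Longrightarrow> \<exists>f g. tensor_stable_coequalizer C f g q"


section \<open>Semigroups and multiplier morphisms\<close>

definition semigroup_ob :: "('o, 'm, 'x) monoidal_data_scheme \<Rightarrow> 'o \<Rightarrow> 'm \<Rightarrow> bool" where
  "semigroup_ob C A m \<longleftrightarrow>
     A \<in> Ob C \<and> m \<in> hom C (A \<odot> A) A \<and>
     m \<cdot> (m \<otimes> \<one> A) = m \<cdot> (\<one> A \<otimes> m) \<cdot> \<alpha> A A A"
  for C (structure)

definition nondegenerate :: "('o, 'm, 'x) monoidal_data_scheme \<Rightarrow> 'o \<Rightarrow> 'm \<Rightarrow> bool" where
  "nondegenerate C A m \<longleftrightarrow>
     semigroup_ob C A m \<and>
     (\<forall>X \<in> Ob C. \<forall>Y \<in> Ob C.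
        inj_on (\<lambda>f. (\<one> Y \<otimes> m) \<cdot> \<alpha> Y A A \<cdot> (f \<otimes> \<one> A)) (hom C X (Y \<odot> A)) \<and>
        inj_on (\<lambda>g. (m \<otimes> \<one> Y) \<cdot> minv (\<alpha> A A Y) \<cdot> (\<one> A \<otimes> g)) (hom C X (A \<odot> Y)))"
  for C (structure)

definition op_mult :: "('o, 'm, 'x) braided_data_scheme \<Rightarrow> 'o \<Rightarrow> 'm \<Rightarrow> 'm" where
  "op_mult C A m = m \<cdot>\<^bsub>C\<^esub> \<c>'\<^bsub>C\<^esub> A A"

text \<open>\<open>M_morphism C A B m f\<close> says that \<open>f\<close> is an $\mathbb M$-morphism from the object \<open>A\<close> to the
  non-degenerate semigroup \<open>(B, m)\<close>; a semigroup structure on \<open>A\<close> plays no role.\<close>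

definition M_morphism ::
  "('o, 'm, 'x) monoidal_data_scheme \<Rightarrow> 'o \<Rightarrow> 'o \<Rightarrow> 'm \<Rightarrow> 'm \<times> 'm \<Rightarrow> bool" where
  "M_morphism C A B m f \<longleftrightarrow>
     A \<in> Ob C \<and> nondegenerate C B m \<and>
     fst f \<in> hom C (A \<odot> B) B \<and> snd f \<in> hom C (B \<odot> A) B \<and>
     m \<cdot> (\<one> B \<otimes> fst f) \<cdot> \<alpha> B A B = m \<cdot> (snd f \<otimes> \<one> B)"
  for C (structure)

text \<open>The $\mathbb M$-morphism $z^\#$ of a morphism \<open>z\<close> to the semigroup \<open>(A, m)\<close>.\<close>

definition sharp :: "('o, 'm, 'x) monoidal_data_scheme \<Rightarrow> 'o \<Rightarrow> 'm \<Rightarrow> 'm \<Rightarrow> 'm \<times> 'm" where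
  "sharp C A m z = (m \<cdot> (z \<otimes> \<one> A), m \<cdot> (\<one> A \<otimes> z))"
  for C (structure)


section \<open>Multiplier bimonoids and regular multiplier Hopf monoids\<close>

text \<open>The morphisms \<open>f1\<close> and \<open>1f\<close> of $(AA)A$ for \<open>f: AA \<rightarrow> AA\<close>, and \<open>e1\<close> and \<open>1e\<close> from $AA$ to $A$
  for \<open>e: A \<rightarrow> I\<close>.\<close>

definition on12 :: "('o, 'm, 'x) monoidal_data_scheme \<Rightarrow> 'o \<Rightarrow> 'm \<Rightarrow> 'm" where
  "on12 C A f = f \<otimes>\<^bsub>C\<^esub> \<one>\<^bsub>C\<^esub> A"

definition on23 :: "('o, 'm, 'x) monoidal_data_scheme \<Rightarrow> 'o \<Rightarrow> 'm \<Rightarrow> 'm" where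
  "on23 C A f = minv (\<alpha> A A A) \<cdot> (\<one> A \<otimes> f) \<cdot> \<alpha> A A A"
  for C (structure)

definition counit_left :: "('o, 'm, 'x) monoidal_data_scheme \<Rightarrow> 'o \<Rightarrow> 'm \<Rightarrow> 'm" where
  "counit_left C A e = \<l>\<^bsub>C\<^esub> A \<cdot>\<^bsub>C\<^esub> (e \<otimes>\<^bsub>C\<^esub> \<one>\<^bsub>C\<^esub> A)"

definition counit_right :: "('o, 'm, 'x) monoidal_data_scheme \<Rightarrow> 'o \<Rightarrow> 'm \<Rightarrow> 'm" where
  "counit_right C A e = \<r>\<^bsub>C\<^esub> A \<cdot>\<^bsub>C\<^esub> (\<one>\<^bsub>C\<^esub> A \<otimes>\<^bsub>C\<^esub> e)"

definition mult :: "('o, 'm, 'x) monoidal_data_scheme \<Rightarrow> 'o \<Rightarrow> 'm \<Rightarrow> 'm \<Rightarrow> 'm" where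
  "mult C A t1 e = counit_left C A e \<cdot>\<^bsub>C\<^esub> t1"

locale multiplier_bimonoid =
  fixes C :: "('o, 'm, 'x) braided_data_scheme" (structure) and A t1 t2 e
  assumes ob: "A \<in> Ob C"
    and t1_hom: "t1 \<in> hom C (A \<odot> A) (A \<odot> A)"
    and t2_hom: "t2 \<in> hom C (A \<odot> A) (A \<odot> A)"
    and e_hom: "e \<in> hom C A \<I>"
    and fusion1: "on12 C A t1 \<cdot> on12 C A (\<c>' A A) \<cdot> on23 C A t1 \<cdot> on12 C A (\<c> A A) \<cdot> on23 C A t1
      = on23 C A t1 \<cdot> on12 C A t1"
    and counit1: "counit_right C A e \<cdot> t1 = counit_right C A e"
    and fusion2: "on23 C A t2 \<cdot> on23 C A (\<c>' A A) \<cdot> on12 C A t2 \<cdot> on23 C A (\<c> A A) \<cdot> on12 C A t2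
      = on12 C A t2 \<cdot> on23 C A t2"
    and counit2: "counit_left C A e \<cdot> t2 = counit_left C A e"
    and compat: "on23 C A t1 \<cdot> on12 C A t2 = on12 C A t2 \<cdot> on23 C A t1"
    and mult_eq: "counit_left C A e \<cdot> t1 = counit_right C A e \<cdot> t2"

locale regular_multiplier_bimonoid =
  fixes C :: "('o, 'm, 'x) braided_data_scheme" (structure) and A t1 t2 t3 t4 e and m
  defines m_def: "m \<equiv> mult C A t1 e"
  assumes bimonoid: "multiplier_bimonoid C A t1 t2 e"
    and inverse_bimonoid: "multiplier_bimonoid (inverse_braided C) A t3 t4 e"
    and mult_t3: "counit_left C A e \<cdot> t1 = counit_left C A e \<cdot> t3 \<cdot> \<c> A A"
    and t1_t3: "(\<one> A \<otimes> m) \<cdot> \<alpha> A A A \<cdot> on12 C A (\<c> A A) \<cdot> on23 C A t1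
      = (\<one> A \<otimes> m) \<cdot> \<alpha> A A A \<cdot> on12 C A t3 \<cdot> on12 C A (\<c> A A)"
    and t4_t1: "on12 C A t4 \<cdot> on23 C A t1 = on23 C A t1 \<cdot> on12 C A t4"
    and t2_t4: "(m \<otimes> \<one> A) \<cdot> on23 C A (\<c> A A) \<cdot> on12 C A t2
      = (m \<otimes> \<one> A) \<cdot> on23 C A t4 \<cdot> on23 C A (\<c> A A)"
    and t3_t2: "on23 C A t3 \<cdot> on12 C A t2 = on12 C A t2 \<cdot> on23 C A t3"

locale regular_multiplier_Hopf_monoid = regular_multiplier_bimonoid +
  assumes t1_iso: "iso C t1"
    and t2_iso: "iso C t2"
    and t3_iso: "iso C t3"
    and t4_iso: "iso C t4"

end

theory Submission
  imports Defs
begin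

text \<open>
  In Sweedler notation \<open>t\<^sub>1(a,b) = a\<^sub>1 \<otimes> a\<^sub>2 b\<close>, \<open>t\<^sub>2(a,b) = a b\<^sub>1 \<otimes> b\<^sub>2\<close>, \<open>t\<^sub>3(a,b) = a\<^sub>1 \<otimes> b a\<^sub>2\<close>,
  \<open>t\<^sub>4(a,b) = b\<^sub>1 a \<otimes> b\<^sub>2\<close> and \<open>s\<^sub>1(a,b) = S(a) b\<close>. Applying the counit to the strands of the fusion equation shows
  that \<open>s\<^sub>1\<close> is right linear and anti-multiplicative, hence \<open>S(b\<^sub>1 a) b\<^sub>2 c = \<epsilon>(b) S(a) c\<close>. Cancelling \<open>c\<close>
  by non-degeneracy, \<open>s\<^sub>1 t\<^sub>4\<close> factors through the regular epimorphism \<open>1\<epsilon>\<close>, and the factorization is the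
  morphism \<open>A \<rightarrow> A\<close> inducing the antipode. Exchanging \<open>(t\<^sub>1,t\<^sub>2)\<close> and \<open>(t\<^sub>3,t\<^sub>4)\<close> gives \<open>S'\<close>. Finally
  \<open>\<phi>(a\<^sub>1) S(b a\<^sub>2) c = \<epsilon>(a) S(b) c\<close> holds both for \<open>\<phi> = S S'\<close> and for \<open>\<phi> = 1\<close>, and since
  \<open>t\<^sub>3\<close> is invertible, \<open>s\<^sub>1\<close> is epi and \<open>m\<close> is non-degenerate, it determines \<open>\<phi>\<close>.
\<close>

section \<open>Coherence in braided monoidal categories\<close>

context category
begin

lemma homD [dest]: "f \<in> hom C X Y \<Longrightarrow> f \<in> Ar C \<and> Dom C f = X \<and> Cod C f = Y"
  by (simp add: hom_def)

lemma hom_ob: "f \<in> hom C X Y \<Longrightarrow> X \<in> Ob C \<and> Y \<in> Ob C"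
  using Dom_closed Cod_closed by blast

declare Dom_closed [simp] Cod_closed [simp]

lemma ident_simps [simp]:
  assumes "X \<in> Ob C"
  shows "\<one> X \<in> Ar C" "Dom C (\<one> X) = X" "Cod C (\<one> X) = X"
  using ident_closed[OF assms] by auto

lemma comp_simps [simp]:
  assumes "f \<in> Ar C" "g \<in> Ar C" "Dom C g = Cod C f"
  shows "g \<cdot> f \<in> Ar C" "Dom C (g \<cdot> f) = Dom C f" "Cod C (g \<cdot> f) = Cod C g"
  using comp_closed[of f "Dom C f" "Cod C f" g "Cod C g"] assms by (simp_all add: hom_def)

lemma assoc_simp [simp]:
  assumes "f \<in> Ar C" "g \<in> Ar C" "h \<in> Ar C" "Dom C g = Cod C f" "Dom C h = Cod C g"
  shows "(h \<cdot> g) \<cdot> f = h \<cdot> g \<cdot> f"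
  using comp_assoc[of f "Dom C f" "Cod C f" g "Cod C g" h "Cod C h"] assms by (simp_all add: hom_def)

lemma ident_left [simp]: "\<lbrakk>f \<in> Ar C; Cod C f = Y\<rbrakk> \<Longrightarrow> \<one> Y \<cdot> f = f"
  using comp_ident_left[of f "Dom C f"] by (simp add: hom_def)

lemma ident_right [simp]: "\<lbrakk>f \<in> Ar C; Dom C f = X\<rbrakk> \<Longrightarrow> f \<cdot> \<one> X = f"
  using comp_ident_right[of f _ "Cod C f"] by (simp add: hom_def)

text \<open>Composites are normalized to the right, so the left side of an equation for
  \<open>a \<cdot> b\<close> does not occur literally in a longer composite. This form applies such
  an equation there.\<close>

lemma chain:
  assumes "a \<cdot> b = r" "a \<in> Ar C" "b \<in> Ar C" "h \<in> Ar C" "Dom C a = Cod C b" "Dom C b = Cod C h"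
  shows "a \<cdot> b \<cdot> h = r \<cdot> h"
  using assms by (metis assoc_simp)

lemma inverse_pairD:
  assumes "inverse_pair C f g"
  shows "f \<in> Ar C" "g \<in> Ar C" "Dom C g = Cod C f" "Cod C g = Dom C f"
    "g \<cdot> f = \<one> (Dom C f)" "f \<cdot> g = \<one> (Cod C f)"
  using assms by (auto simp: inverse_pair_def hom_def)

lemma inverse_pair_unique:
  assumes "inverse_pair C f g" "inverse_pair C f g'"
  shows "g' = g"
proof -
  note * = inverse_pairD[OF assms(1)] inverse_pairD[OF assms(2)]
  have "g' = g' \<cdot> f \<cdot> g" using * by simp
  also have "\<dots> = (g' \<cdot> f) \<cdot> g" using * by (intro assoc_simp[symmetric]) auto
  also have "\<dots> = g" using * by simp
  finally show ?thesis .
qed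

lemma inv_morI: "inverse_pair C f g \<Longrightarrow> minv f = g"
  unfolding inv_mor_def using inverse_pair_unique by blast

lemma isoI: "inverse_pair C f g \<Longrightarrow> iso C f"
  by (auto simp: iso_def)

lemma inverse_pair_inv_mor: "iso C f \<Longrightarrow> inverse_pair C f (minv f)"
  using inv_morI iso_def by metis

lemma inverse_pair_sym: "inverse_pair C f g \<Longrightarrow> inverse_pair C g f"
  by (auto simp: inverse_pair_def hom_def)

lemma iso_Ar: "iso C f \<Longrightarrow> f \<in> Ar C"
  by (auto simp: iso_def dest: inverse_pairD)

lemma inv_mor_simps [simp]:
  assumes "iso C f"
  shows "minv f \<in> Ar C" "Dom C (minv f) = Cod C f" "Cod C (minv f) = Dom C f"
    "minv f \<cdot> f = \<one> (Dom C f)" "f \<cdot> minv f = \<one> (Cod C f)"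
  using inverse_pairD[OF inverse_pair_inv_mor[OF assms]] by auto

lemma inv_mor_chain [simp]:
  assumes "iso C f" "h \<in> Ar C"
  shows "Cod C h = Dom C f \<Longrightarrow> minv f \<cdot> f \<cdot> h = h"
    "Cod C h = Cod C f \<Longrightarrow> f \<cdot> minv f \<cdot> h = h"
  using assms iso_Ar[OF assms(1)] by (simp_all add: chain[OF inv_mor_simps(4)] chain[OF inv_mor_simps(5)])

lemma iso_inv_mor [simp]: "iso C f \<Longrightarrow> iso C (minv f)"
  using inverse_pair_inv_mor inverse_pair_sym isoI by metis

lemma inv_mor_inv_mor: "iso C f \<Longrightarrow> minv (minv f) = f"
  using inverse_pair_inv_mor inverse_pair_sym inv_morI by metis

lemma iso_ident [simp]: "X \<in> Ob C \<Longrightarrow> iso C (\<one> X)"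
  by (rule isoI[of _ "\<one> X"]) (simp add: inverse_pair_def hom_def)

lemma iso_comp [simp]:
  assumes "iso C f" "iso C g" "Dom C g = Cod C f"
  shows "iso C (g \<cdot> f)"
  by (rule isoI[of _ "minv f \<cdot> minv g"])
    (use assms iso_Ar[OF assms(1)] iso_Ar[OF assms(2)] in \<open>simp add: inverse_pair_def hom_def\<close>)

lemma iso_cancel_right:
  assumes "iso C f" "a \<in> Ar C" "b \<in> Ar C" "Dom C a = Cod C f" "Dom C b = Cod C f"
    and "a \<cdot> f = b \<cdot> f"
  shows "a = b"
proof -
  have "(a \<cdot> f) \<cdot> minv f = (b \<cdot> f) \<cdot> minv f" using assms by simp
  then show ?thesis using assms(1-5) iso_Ar[OF assms(1)] by simp
qed

lemma iso_cancel_left: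
  assumes "iso C f" "a \<in> Ar C" "b \<in> Ar C" "Cod C a = Dom C f" "Cod C b = Dom C f"
    and "f \<cdot> a = f \<cdot> b"
  shows "a = b"
proof -
  have "minv f \<cdot> f \<cdot> a = minv f \<cdot> f \<cdot> b" using assms by simp
  then show ?thesis using assms(1-5) by simp
qed

lemma coequalizer_factor:
  assumes "coequalizer C a b q" and h: "h \<in> hom C (Dom C q) W" "h \<cdot> a = h \<cdot> b"
  obtains k where "k \<in> hom C (Cod C q) W" "k \<cdot> q = h"
proof -
  obtain X Y Z where qh: "q \<in> hom C Y Z"
    and un: "\<forall>W. \<forall>h \<in> hom C Y W. h \<cdot> a = h \<cdot> b \<longrightarrow> (\<exists>!k. k \<in> hom C Z W \<and> k \<cdot> q = h)"
    using assms(1) unfolding coequalizer_def by (elim exE conjE) (rule that)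
  have "Dom C q = Y" "Cod C q = Z"
    using qh by auto
  then have "\<exists>!k. k \<in> hom C (Cod C q) W \<and> k \<cdot> q = h"
    using un[rule_format, of h W] h by simp
  then show ?thesis
    using that by metis
qed

text \<open>The composite \<open>f \<cdot> q\<close> identifies the pair whose coequalizer is
  \<open>q\<close>; both \<open>f\<close> and \<open>g\<close> are its unique factorization.\<close>

lemma regular_epi_cancel:
  assumes q: "regular_epi C q" and f: "f \<in> hom C (Cod C q) W" and g: "g \<in> hom C (Cod C q) W"
    and eq: "f \<cdot> q = g \<cdot> q"
  shows "f = g"
proof -
  obtain a b where "coequalizer C a b q"
    using q by (auto simp: regular_epi_def)
  then obtain X Y Z where a: "a \<in> hom C X Y" and b: "b \<in> hom C X Y" and qh: "q \<in> hom C Y Z"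
    and qab: "q \<cdot> a = q \<cdot> b"
    and un: "\<forall>W. \<forall>h \<in> hom C Y W. h \<cdot> a = h \<cdot> b \<longrightarrow> (\<exists>!k. k \<in> hom C Z W \<and> k \<cdot> q = h)"
    unfolding coequalizer_def by (elim exE conjE) (rule that)
  have Z: "Cod C q = Z"
    using qh by auto
  note f = f[unfolded Z] and g = g[unfolded Z]
  have "(f \<cdot> q) \<cdot> a = (f \<cdot> q) \<cdot> b"
    by (simp only: comp_assoc[OF a qh f] comp_assoc[OF b qh f] qab)
  then have "\<exists>!k. k \<in> hom C Z W \<and> k \<cdot> q = f \<cdot> q"
    by (rule un[rule_format, OF comp_closed[OF qh f]])
  then show ?thesis
    using f g eq by metis
qed

end

section \<open>Coherence of the unit constraints\<close>

context monoidal_category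
begin

declare unit_ob_closed [simp] tensor_ob_closed [simp] tensor_ident [simp]

lemma tensor_simps [simp]:
  assumes "f \<in> Ar C" "g \<in> Ar C"
  shows "f \<otimes> g \<in> Ar C" "Dom C (f \<otimes> g) = Dom C f \<odot> Dom C g" "Cod C (f \<otimes> g) = Cod C f \<odot> Cod C g"
  using tensor_closed[of f "Dom C f" "Cod C f" g "Dom C g" "Cod C g"] assms by (simp_all add: hom_def)

lemma interchange_simp [simp]:
  assumes "f \<in> Ar C" "f' \<in> Ar C" "g \<in> Ar C" "g' \<in> Ar C" "Dom C f' = Cod C f" "Dom C g' = Cod C g"
  shows "(f' \<otimes> g') \<cdot> (f \<otimes> g) = (f' \<cdot> f) \<otimes> (g' \<cdot> g)"
  using interchange[of f "Dom C f" "Cod C f" f' "Cod C f'" g "Dom C g" "Cod C g" g' "Cod C g'"] assms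
  by (simp add: hom_def)

lemma interchange_chain [simp]:
  assumes "f \<in> Ar C" "f' \<in> Ar C" "g \<in> Ar C" "g' \<in> Ar C" "Dom C f' = Cod C f" "Dom C g' = Cod C g"
    "h \<in> Ar C" "Cod C h = Dom C f \<odot> Dom C g"
  shows "(f' \<otimes> g') \<cdot> (f \<otimes> g) \<cdot> h = ((f' \<cdot> f) \<otimes> (g' \<cdot> g)) \<cdot> h"
  using assms chain[OF interchange_simp] by simp

lemma assoc_simps [simp]:
  assumes "X \<in> Ob C" "Y \<in> Ob C" "Z \<in> Ob C"
  shows "\<alpha> X Y Z \<in> Ar C" "Dom C (\<alpha> X Y Z) = X \<odot> Y \<odot> Z" "Cod C (\<alpha> X Y Z) = X \<odot> (Y \<odot> Z)"
    "iso C (\<alpha> X Y Z)"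
  using assoc_closed[OF assms] assoc_iso[OF assms] by auto

lemma lunit_simps [simp]:
  assumes "X \<in> Ob C"
  shows "\<l> X \<in> Ar C" "Dom C (\<l> X) = \<I> \<odot> X" "Cod C (\<l> X) = X" "iso C (\<l> X)"
  using lunit_closed[OF assms] lunit_iso[OF assms] by auto

lemma runit_simps [simp]:
  assumes "X \<in> Ob C"
  shows "\<r> X \<in> Ar C" "Dom C (\<r> X) = X \<odot> \<I>" "Cod C (\<r> X) = X" "iso C (\<r> X)"
  using runit_closed[OF assms] runit_iso[OF assms] by auto

lemma iso_tensor [simp]:
  assumes "iso C f" "iso C g"
  shows "iso C (f \<otimes> g)"
  by (rule isoI[of _ "minv f \<otimes> minv g"])
    (use assms iso_Ar[OF assms(1)] iso_Ar[OF assms(2)] in \<open>simp add: inverse_pair_def hom_def\<close>)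

lemma assoc_nat:
  assumes "f \<in> Ar C" "g \<in> Ar C" "h \<in> Ar C" "Cod C f = X" "Cod C g = Y" "Cod C h = Z"
  shows "\<alpha> X Y Z \<cdot> ((f \<otimes> g) \<otimes> h) = (f \<otimes> (g \<otimes> h)) \<cdot> \<alpha> (Dom C f) (Dom C g) (Dom C h)"
  using assoc_natural[of f "Dom C f" X g "Dom C g" Y h "Dom C h" Z] assms by (simp_all add: hom_def)

lemma lunit_nat: "f \<in> Ar C \<Longrightarrow> \<l> (Cod C f) \<cdot> (\<one> \<I> \<otimes> f) = f \<cdot> \<l> (Dom C f)"
  using lunit_natural[of f "Dom C f" "Cod C f"] by (simp add: hom_def)

lemma runit_nat: "f \<in> Ar C \<Longrightarrow> \<r> (Cod C f) \<cdot> (f \<otimes> \<one> \<I>) = f \<cdot> \<r> (Dom C f)"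
  using runit_natural[of f "Dom C f" "Cod C f"] by (simp add: hom_def)

text \<open>Naturality of \<open>\<l>\<close> recovers \<open>f\<close> from
  \<open>\<one> \<I> \<otimes> f\<close> by conjugation with isomorphisms. It allows the coherence
  laws below to be checked after adding a unit strand.\<close>

lemma unit_tensor_faithful:
  assumes "f \<in> Ar C" "g \<in> Ar C" "Dom C f = Dom C g" "Cod C f = Cod C g"
    and "\<one> \<I> \<otimes> f = \<one> \<I> \<otimes> g"
  shows "f = g"
proof (rule iso_cancel_right[of "\<l> (Dom C f)"])
  show "f \<cdot> \<l> (Dom C f) = g \<cdot> \<l> (Dom C f)"
    using lunit_nat[of f] lunit_nat[of g] assms by simp
qed (use assms in simp_all)

lemma tensor_unit_faithful:
  assumes "f \<in> Ar C" "g \<in> Ar C" "Dom C f = Dom C g" "Cod C f = Cod C g"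
    and "f \<otimes> \<one> \<I> = g \<otimes> \<one> \<I>"
  shows "f = g"
proof (rule iso_cancel_right[of "\<r> (Dom C f)"])
  show "f \<cdot> \<r> (Dom C f) = g \<cdot> \<r> (Dom C f)"
    using runit_nat[of f] runit_nat[of g] assms by simp
qed (use assms in simp_all)

text \<open>Kelly's argument: after tensoring with \<open>\<I>\<close> on the left, the pentagon at
  \<open>\<I>, \<I>, X, Y\<close> and two triangles give the equation up to the isomorphism
  \<open>?p\<close>.\<close>

lemma lunit_tensor:
  assumes [simp]: "X \<in> Ob C" "Y \<in> Ob C"
  shows "\<l> (X \<odot> Y) \<cdot> \<alpha> \<I> X Y = \<l> X \<otimes> \<one> Y"
proof (rule unit_tensor_faithful)
  let ?p = "\<alpha> \<I> (\<I> \<odot> X) Y \<cdot> (\<alpha> \<I> \<I> X \<otimes> \<one> Y)"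
  have "(\<one> \<I> \<otimes> (\<l> (X \<odot> Y) \<cdot> \<alpha> \<I> X Y)) \<cdot> ?p
      = (\<one> \<I> \<otimes> \<l> (X \<odot> Y)) \<cdot> (\<one> \<I> \<otimes> \<alpha> \<I> X Y) \<cdot> ?p" by simp
  also have "\<dots> = (\<one> \<I> \<otimes> \<l> (X \<odot> Y)) \<cdot> \<alpha> \<I> \<I> (X \<odot> Y) \<cdot> \<alpha> (\<I> \<odot> \<I>) X Y"
    using pentagon[of \<I> \<I> X Y] by simp
  also have "\<dots> = (\<r> \<I> \<otimes> \<one> (X \<odot> Y)) \<cdot> \<alpha> (\<I> \<odot> \<I>) X Y"
    by (subst chain[OF triangle]) simp_all
  also have "\<dots> = \<alpha> \<I> X Y \<cdot> ((\<r> \<I> \<otimes> \<one> X) \<otimes> \<one> Y)"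
    using assoc_nat[of "\<r> \<I>" "\<one> X" "\<one> Y"] by simp
  also have "\<dots> = \<alpha> \<I> X Y \<cdot> ((\<one> \<I> \<otimes> \<l> X) \<otimes> \<one> Y) \<cdot> (\<alpha> \<I> \<I> X \<otimes> \<one> Y)"
    by (simp add: triangle)
  also have "\<dots> = (\<one> \<I> \<otimes> (\<l> X \<otimes> \<one> Y)) \<cdot> ?p"
    using chain[OF assoc_nat[of "\<one> \<I>" "\<l> X" "\<one> Y"], of \<I> X Y "\<alpha> \<I> \<I> X \<otimes> \<one> Y"]
    by (simp del: interchange_simp)
  finally show "\<one> \<I> \<otimes> (\<l> (X \<odot> Y) \<cdot> \<alpha> \<I> X Y) = \<one> \<I> \<otimes> (\<l> X \<otimes> \<one> Y)"
    by (rule iso_cancel_right[rotated -1]) simp_all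
qed simp_all

text \<open>Mirror image of \<open>lunit_tensor\<close>, from the pentagon at
  \<open>X, Y, \<I>, \<I>\<close>.\<close>

lemma runit_tensor:
  assumes [simp]: "X \<in> Ob C" "Y \<in> Ob C"
  shows "(\<one> X \<otimes> \<r> Y) \<cdot> \<alpha> X Y \<I> = \<r> (X \<odot> Y)"
proof (rule tensor_unit_faithful)
  have "\<alpha> X Y \<I> \<cdot> (((\<one> X \<otimes> \<r> Y) \<cdot> \<alpha> X Y \<I>) \<otimes> \<one> \<I>)
      = \<alpha> X Y \<I> \<cdot> ((\<one> X \<otimes> \<r> Y) \<otimes> \<one> \<I>) \<cdot> (\<alpha> X Y \<I> \<otimes> \<one> \<I>)" by simp
  also have "\<dots> = (\<one> X \<otimes> (\<r> Y \<otimes> \<one> \<I>)) \<cdot> \<alpha> X (Y \<odot> \<I>) \<I> \<cdot> (\<alpha> X Y \<I> \<otimes> \<one> \<I>)"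
    using chain[OF assoc_nat[of "\<one> X" "\<r> Y" "\<one> \<I>"], of X Y \<I> "\<alpha> X Y \<I> \<otimes> \<one> \<I>"]
    by (simp del: interchange_simp)
  also have "\<dots> = (\<one> X \<otimes> (\<one> Y \<otimes> \<l> \<I>)) \<cdot> (\<one> X \<otimes> \<alpha> Y \<I> \<I>) \<cdot> \<alpha> X (Y \<odot> \<I>) \<I> \<cdot> (\<alpha> X Y \<I> \<otimes> \<one> \<I>)"
    by (simp add: triangle)
  also have "\<dots> = (\<one> X \<otimes> (\<one> Y \<otimes> \<l> \<I>)) \<cdot> \<alpha> X Y (\<I> \<odot> \<I>) \<cdot> \<alpha> (X \<odot> Y) \<I> \<I>"
    by (subst pentagon) simp_all
  also have "\<dots> = \<alpha> X Y \<I> \<cdot> (\<one> (X \<odot> Y) \<otimes> \<l> \<I>) \<cdot> \<alpha> (X \<odot> Y) \<I> \<I>"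
    using chain[OF assoc_nat[of "\<one> X" "\<one> Y" "\<l> \<I>"], of X Y \<I> "\<alpha> (X \<odot> Y) \<I> \<I>"]
    by simp
  also have "\<dots> = \<alpha> X Y \<I> \<cdot> (\<r> (X \<odot> Y) \<otimes> \<one> \<I>)"
    by (simp add: triangle)
  finally show "((\<one> X \<otimes> \<r> Y) \<cdot> \<alpha> X Y \<I>) \<otimes> \<one> \<I> = \<r> (X \<odot> Y) \<otimes> \<one> \<I>"
    by (rule iso_cancel_left[rotated -1]) simp_all
qed simp_all

text \<open>Naturality of \<open>\<l>\<close> at \<open>\<l> \<I>\<close> itself identifies
  \<open>\<l> (\<I> \<odot> \<I>)\<close> with \<open>\<one> \<I> \<otimes> \<l> \<I>\<close>; then
  \<open>lunit_tensor\<close> and the triangle have the same left side.\<close>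

lemma lunit_unit: "\<l> \<I> = \<r> \<I>"
proof (rule tensor_unit_faithful)
  have "\<l> (\<I> \<odot> \<I>) = \<one> \<I> \<otimes> \<l> \<I>"
    by (rule iso_cancel_left[of "\<l> \<I>"]) (use lunit_nat[of "\<l> \<I>"] in simp_all)
  then show "\<l> \<I> \<otimes> \<one> \<I> = \<r> \<I> \<otimes> \<one> \<I>"
    using lunit_tensor[of \<I> \<I>] triangle[of \<I> \<I>] by simp
qed simp_all

end

section \<open>Braiding with the unit object\<close>

context braided_monoidal_category
begin

lemma braid_simps [simp]:
  assumes "X \<in> Ob C" "Y \<in> Ob C"
  shows "\<c> X Y \<in> Ar C" "Dom C (\<c> X Y) = X \<odot> Y" "Cod C (\<c> X Y) = Y \<odot> X" "iso C (\<c> X Y)"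
  using braid_closed[OF assms] braid_iso[OF assms] by auto

lemma braid_nat:
  assumes "f \<in> Ar C" "g \<in> Ar C"
  shows "\<c> (Cod C f) (Cod C g) \<cdot> (f \<otimes> g) = (g \<otimes> f) \<cdot> \<c> (Dom C f) (Dom C g)"
  using braid_natural[of f "Dom C f" _ g "Dom C g"] assms by (simp_all add: hom_def)

text \<open>The first hexagon at \<open>X, \<I>, \<I>\<close> and naturality of the braiding give
  the equation with a unit strand added and \<open>\<c> X \<I>\<close> in front; both can be
  cancelled.\<close>

lemma lunit_braid:
  assumes [simp]: "X \<in> Ob C"
  shows "\<l> X \<cdot> \<c> X \<I> = \<r> X"
proof (rule tensor_unit_faithful)
  have "\<c> X \<I> \<cdot> ((\<l> X \<cdot> \<c> X \<I>) \<otimes> \<one> \<I>) = \<c> X \<I> \<cdot> (\<l> X \<otimes> \<one> \<I>) \<cdot> (\<c> X \<I> \<otimes> \<one> \<I>)" by simp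
  also have "\<dots> = \<c> X \<I> \<cdot> (\<l> (X \<odot> \<I>) \<cdot> \<alpha> \<I> X \<I>) \<cdot> (\<c> X \<I> \<otimes> \<one> \<I>)"
    by (simp only: lunit_tensor assms unit_ob_closed)
  also have "\<dots> = (\<l> (\<I> \<odot> X) \<cdot> (\<one> \<I> \<otimes> \<c> X \<I>)) \<cdot> \<alpha> \<I> X \<I> \<cdot> (\<c> X \<I> \<otimes> \<one> \<I>)"
    using lunit_nat[of "\<c> X \<I>"] by simp
  also have "\<dots> = \<l> (\<I> \<odot> X) \<cdot> \<alpha> \<I> \<I> X \<cdot> \<c> X (\<I> \<odot> \<I>) \<cdot> \<alpha> X \<I> \<I>"
    using hexagon1[of X \<I> \<I>] by simp
  also have "\<dots> = (\<l> \<I> \<otimes> \<one> X) \<cdot> \<c> X (\<I> \<odot> \<I>) \<cdot> \<alpha> X \<I> \<I>"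
    by (subst chain[OF lunit_tensor]) simp_all
  also have "\<dots> = \<c> X \<I> \<cdot> (\<one> X \<otimes> \<l> \<I>) \<cdot> \<alpha> X \<I> \<I>"
    using chain[OF braid_nat[of "\<one> X" "\<l> \<I>"], of "\<alpha> X \<I> \<I>"] by simp
  also have "\<dots> = \<c> X \<I> \<cdot> (\<r> X \<otimes> \<one> \<I>)"
    by (simp add: triangle)
  finally show "(\<l> X \<cdot> \<c> X \<I>) \<otimes> \<one> \<I> = \<r> X \<otimes> \<one> \<I>"
    by (rule iso_cancel_left[rotated -1]) simp_all
qed simp_all

text \<open>The same argument with the second hexagon at \<open>\<I>, \<I>, X\<close>.\<close>

lemma runit_braid:
  assumes [simp]: "X \<in> Ob C"
  shows "\<r> X \<cdot> \<c> \<I> X = \<l> X"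
proof (rule unit_tensor_faithful)
  have r: "\<r> (X \<odot> \<I>) \<cdot> minv (\<alpha> X \<I> \<I>) = \<one> X \<otimes> \<r> \<I>"
    and r': "\<r> (\<I> \<odot> X) \<cdot> minv (\<alpha> \<I> X \<I>) = \<one> \<I> \<otimes> \<r> X"
    using runit_tensor[of X \<I>, symmetric] runit_tensor[of \<I> X, symmetric] by simp_all
  have "\<c> \<I> X \<cdot> (\<one> \<I> \<otimes> (\<r> X \<cdot> \<c> \<I> X)) = \<c> \<I> X \<cdot> (\<one> \<I> \<otimes> \<r> X) \<cdot> (\<one> \<I> \<otimes> \<c> \<I> X)" by simp
  also have "\<dots> = \<c> \<I> X \<cdot> (\<r> (\<I> \<odot> X) \<cdot> minv (\<alpha> \<I> X \<I>)) \<cdot> (\<one> \<I> \<otimes> \<c> \<I> X)"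
    by (simp only: r')
  also have "\<dots> = (\<r> (X \<odot> \<I>) \<cdot> (\<c> \<I> X \<otimes> \<one> \<I>)) \<cdot> minv (\<alpha> \<I> X \<I>) \<cdot> (\<one> \<I> \<otimes> \<c> \<I> X)"
    using runit_nat[of "\<c> \<I> X"] by simp
  also have "\<dots> = \<r> (X \<odot> \<I>) \<cdot> minv (\<alpha> X \<I> \<I>) \<cdot> \<c> (\<I> \<odot> \<I>) X \<cdot> minv (\<alpha> \<I> \<I> X)"
    using hexagon2[of \<I> \<I> X] by simp
  also have "\<dots> = (\<one> X \<otimes> \<r> \<I>) \<cdot> \<c> (\<I> \<odot> \<I>) X \<cdot> minv (\<alpha> \<I> \<I> X)"
    by (subst chain[OF r]) simp_all
  also have "\<dots> = \<c> \<I> X \<cdot> (\<r> \<I> \<otimes> \<one> X) \<cdot> minv (\<alpha> \<I> \<I> X)"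
    using chain[OF braid_nat[of "\<r> \<I>" "\<one> X"], of "minv (\<alpha> \<I> \<I> X)"] by simp
  also have "\<dots> = \<c> \<I> X \<cdot> (\<one> \<I> \<otimes> \<l> X)"
    by (simp add: triangle[symmetric])
  finally show "\<one> \<I> \<otimes> (\<r> X \<cdot> \<c> \<I> X) = \<one> \<I> \<otimes> \<l> X"
    by (rule iso_cancel_left[rotated -1]) simp_all
qed simp_all

end

section \<open>Operators on three strands\<close>

text \<open>While \<open>on12\<close> and \<open>on23\<close> act on \<open>(AA)A\<close>, \<open>act23\<close> is the operator \<open>1f\<close> for morphisms \<open>f\<close> out of \<open>AA\<close> with arbitrary
  codomain, whose result \<open>A(-)\<close> needs no rebracketing.\<close>

definition act23 :: "('o, 'm, 'x) monoidal_data_scheme \<Rightarrow> 'o \<Rightarrow> 'm \<Rightarrow> 'm" where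
  "act23 C A f = (\<one> A \<otimes> f) \<cdot> \<alpha> A A A"
  for C (structure)

section \<open>Counits on strands, and cancellation in non-degenerate semigroups\<close>

context monoidal_category
begin

lemma on12_simps [simp]:
  assumes "A \<in> Ob C" "f \<in> Ar C"
  shows "on12 C A f \<in> Ar C" "Dom C (on12 C A f) = Dom C f \<odot> A" "Cod C (on12 C A f) = Cod C f \<odot> A"
  using assms by (simp_all add: on12_def)

lemma act23_simps [simp]:
  assumes "A \<in> Ob C" "f \<in> Ar C" "Dom C f = A \<odot> A"
  shows "act23 C A f \<in> Ar C" "Dom C (act23 C A f) = A \<odot> A \<odot> A" "Cod C (act23 C A f) = A \<odot> Cod C f"
  using assms by (simp_all add: act23_def)

lemma on23_simps [simp]:
  assumes "A \<in> Ob C" "f \<in> Ar C" "Dom C f = A \<odot> A" "Cod C f = A \<odot> A"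
  shows "on23 C A f \<in> Ar C" "Dom C (on23 C A f) = A \<odot> A \<odot> A" "Cod C (on23 C A f) = A \<odot> A \<odot> A"
  using assms by (simp_all add: on23_def)

lemma on12_comp:
  assumes "A \<in> Ob C" "f \<in> Ar C" "g \<in> Ar C" "Dom C g = Cod C f"
  shows "on12 C A g \<cdot> on12 C A f = on12 C A (g \<cdot> f)"
  using assms by (simp add: on12_def)

lemma act23_on23:
  assumes "A \<in> Ob C" "f \<in> Ar C" "Dom C f = A \<odot> A" "Cod C f = A \<odot> A" "g \<in> Ar C" "Dom C g = A \<odot> A"
  shows "act23 C A g \<cdot> on23 C A f = act23 C A (g \<cdot> f)"
  using assms by (simp add: on23_def act23_def)

lemma iso_on12: "\<lbrakk>A \<in> Ob C; iso C f\<rbrakk> \<Longrightarrow> iso C (on12 C A f)"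
  by (simp add: on12_def)

lemma iso_on23:
  assumes "A \<in> Ob C" "iso C f" "Dom C f = A \<odot> A" "Cod C f = A \<odot> A"
  shows "iso C (on23 C A f)"
  using assms iso_Ar[OF assms(2)] by (simp add: on23_def)

lemma act23_comp:
  assumes "A \<in> Ob C" "f \<in> Ar C" "Dom C f = A \<odot> A" "g \<in> Ar C" "Dom C g = Cod C f"
  shows "act23 C A (g \<cdot> f) = (\<one> A \<otimes> g) \<cdot> act23 C A f"
  using assms by (simp add: act23_def)

lemma act23_tensor:
  assumes "A \<in> Ob C" "f \<in> Ar C" "g \<in> Ar C" "h \<in> Ar C" "k \<in> Ar C"
    "Cod C f = A" "Cod C g = A" "Cod C h = A" "Dom C k = A \<odot> A"
    "Dom C f = A" "Dom C g = A" "Dom C h = A"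
  shows "act23 C A k \<cdot> ((f \<otimes> g) \<otimes> h) = (f \<otimes> (k \<cdot> (g \<otimes> h))) \<cdot> \<alpha> A A A"
  using assms by (simp add: act23_def assoc_nat)

lemma counit_simps [simp]:
  assumes "A \<in> Ob C" "e \<in> Ar C" "Dom C e = A" "Cod C e = \<I>"
  shows "counit_left C A e \<in> Ar C" "Dom C (counit_left C A e) = A \<odot> A" "Cod C (counit_left C A e) = A"
    "counit_right C A e \<in> Ar C" "Dom C (counit_right C A e) = A \<odot> A" "Cod C (counit_right C A e) = A"
  using assms by (simp_all add: counit_left_def counit_right_def)

text \<open>The counit erases the first strand, which \<open>f\<close> does not touch, so the two
  commute. The codomain of \<open>f\<close> is arbitrary, hence the counit is spelled out on the
  left.\<close>

lemma counit_left_act23: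
  assumes "A \<in> Ob C" "e \<in> Ar C" "Dom C e = A" "Cod C e = \<I>"
    "f \<in> Ar C" "Dom C f = A \<odot> A"
  shows "\<l> (Cod C f) \<cdot> (e \<otimes> \<one> (Cod C f)) \<cdot> act23 C A f = f \<cdot> on12 C A (counit_left C A e)"
proof -
  have "\<l> (Cod C f) \<cdot> (e \<otimes> \<one> (Cod C f)) \<cdot> act23 C A f
      = (\<l> (Cod C f) \<cdot> (\<one> \<I> \<otimes> f)) \<cdot> (e \<otimes> (\<one> A \<otimes> \<one> A)) \<cdot> \<alpha> A A A"
    using assms by (simp add: act23_def)
  also have "\<dots> = f \<cdot> \<l> (A \<odot> A) \<cdot> (e \<otimes> (\<one> A \<otimes> \<one> A)) \<cdot> \<alpha> A A A"
    using assms by (simp add: lunit_nat)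
  also have "\<dots> = f \<cdot> \<l> (A \<odot> A) \<cdot> \<alpha> \<I> A A \<cdot> ((e \<otimes> \<one> A) \<otimes> \<one> A)"
    using assms assoc_nat[of e "\<one> A" "\<one> A"] by simp
  also have "\<dots> = f \<cdot> (\<l> A \<otimes> \<one> A) \<cdot> ((e \<otimes> \<one> A) \<otimes> \<one> A)"
    using assms by (simp add: chain[OF lunit_tensor] del: interchange_simp)
  finally show ?thesis
    using assms by (simp add: on12_def counit_left_def)
qed

text \<open>Both sides erase the middle strand; the triangle axiom says that it may be absorbed into
  either neighbour.\<close>

lemma act23_counit_left:
  assumes "A \<in> Ob C" "e \<in> Ar C" "Dom C e = A" "Cod C e = \<I>"
  shows "act23 C A (counit_left C A e) = on12 C A (counit_right C A e)"
proof -
  have "act23 C A (counit_left C A e) = (\<one> A \<otimes> \<l> A) \<cdot> (\<one> A \<otimes> (e \<otimes> \<one> A)) \<cdot> \<alpha> A A A"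
    using assms by (simp add: act23_def counit_left_def)
  also have "\<dots> = (\<one> A \<otimes> \<l> A) \<cdot> \<alpha> A \<I> A \<cdot> ((\<one> A \<otimes> e) \<otimes> \<one> A)"
    using assms assoc_nat[of "\<one> A" e "\<one> A"] by (simp del: interchange_chain)
  also have "\<dots> = (\<r> A \<otimes> \<one> A) \<cdot> ((\<one> A \<otimes> e) \<otimes> \<one> A)"
    using assms by (simp add: chain[OF triangle] del: interchange_simp)
  finally show ?thesis
    using assms by (simp add: on12_def counit_right_def)
qed

text \<open>Both sides erase the first two strands; they agree because
  \<open>\<l> \<I> = \<r> \<I>\<close>.\<close>

lemma counit_left_on12_counit:
  assumes "A \<in> Ob C" "e \<in> Ar C" "Dom C e = A" "Cod C e = \<I>"
  shows "counit_left C A e \<cdot> on12 C A (counit_left C A e) = counit_left C A e \<cdot> on12 C A (counit_right C A e)"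
proof -
  have "e \<cdot> counit_left C A e = \<l> \<I> \<cdot> (e \<otimes> e)"
    using assms chain[OF lunit_nat[of e, symmetric], of "e \<otimes> \<one> A"] by (simp add: counit_left_def)
  moreover have "e \<cdot> counit_right C A e = \<l> \<I> \<cdot> (e \<otimes> e)"
    using assms chain[OF runit_nat[of e, symmetric], of "\<one> A \<otimes> e"] by (simp add: counit_right_def lunit_unit)
  ultimately have "e \<cdot> counit_left C A e = e \<cdot> counit_right C A e" by simp
  moreover have "counit_left C A e \<cdot> on12 C A k = \<l> A \<cdot> ((e \<cdot> k) \<otimes> \<one> A)"
    if "k \<in> Ar C" "Cod C k = A" for k
    using that assms by (simp add: on12_def counit_left_def)
  ultimately show ?thesis
    using assms by simp
qed

text \<open>This is non-degeneracy at \<open>Y = \<I>\<close>, with the unit strand removed by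
  \<open>\<l> A\<close>.\<close>

lemma nondegenerate_left_cancel:
  assumes "nondegenerate C A m"
    and "f \<in> hom C X A" "g \<in> hom C X A" "m \<cdot> (f \<otimes> \<one> A) = m \<cdot> (g \<otimes> \<one> A)"
  shows "f = g"
proof -
  have o [simp]: "A \<in> Ob C" "m \<in> Ar C" "Dom C m = A \<odot> A" "Cod C m = A"
    using assms(1) by (auto simp: nondegenerate_def semigroup_ob_def hom_def)
  have h [simp]: "f \<in> Ar C" "Dom C f = X" "Cod C f = A" "g \<in> Ar C" "Dom C g = X" "Cod C g = A" "X \<in> Ob C"
    using assms(2,3) hom_ob[OF assms(2)] by auto
  have *: "(\<one> \<I> \<otimes> m) \<cdot> \<alpha> \<I> A A \<cdot> ((minv (\<l> A) \<cdot> k) \<otimes> \<one> A) = minv (\<l> A) \<cdot> m \<cdot> (k \<otimes> \<one> A)"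
    if [simp]: "k \<in> Ar C" "Dom C k = X" "Cod C k = A" for k
  proof (rule iso_cancel_left[of "\<l> A"])
    have "\<l> A \<cdot> (\<one> \<I> \<otimes> m) \<cdot> \<alpha> \<I> A A \<cdot> ((minv (\<l> A) \<cdot> k) \<otimes> \<one> A)
        = (\<l> A \<cdot> (\<one> \<I> \<otimes> m)) \<cdot> \<alpha> \<I> A A \<cdot> ((minv (\<l> A) \<cdot> k) \<otimes> \<one> A)" by simp
    also have "\<dots> = m \<cdot> (\<l> (A \<odot> A) \<cdot> \<alpha> \<I> A A) \<cdot> ((minv (\<l> A) \<cdot> k) \<otimes> \<one> A)"
      using lunit_nat[of m] by simp
    also have "\<dots> = m \<cdot> (\<l> A \<otimes> \<one> A) \<cdot> ((minv (\<l> A) \<cdot> k) \<otimes> \<one> A)"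
      by (simp only: lunit_tensor o)
    also have "\<dots> = m \<cdot> (k \<otimes> \<one> A)" by simp
    finally show "\<l> A \<cdot> (\<one> \<I> \<otimes> m) \<cdot> \<alpha> \<I> A A \<cdot> ((minv (\<l> A) \<cdot> k) \<otimes> \<one> A)
        = \<l> A \<cdot> minv (\<l> A) \<cdot> m \<cdot> (k \<otimes> \<one> A)" by simp
  qed simp_all
  have "inj_on (\<lambda>f. (\<one> \<I> \<otimes> m) \<cdot> \<alpha> \<I> A A \<cdot> (f \<otimes> \<one> A)) (hom C X (\<I> \<odot> A))"
    using assms(1) by (simp add: nondegenerate_def)
  then have "minv (\<l> A) \<cdot> f = minv (\<l> A) \<cdot> g"
    by (rule inj_onD) (use * assms(4) in \<open>simp_all add: hom_def\<close>)
  then show ?thesis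
    by (rule iso_cancel_left[rotated -1]) simp_all
qed

lemma nondegenerate_right_cancel:
  assumes "nondegenerate C A m"
    and "f \<in> hom C X A" "g \<in> hom C X A" "m \<cdot> (\<one> A \<otimes> f) = m \<cdot> (\<one> A \<otimes> g)"
  shows "f = g"
proof -
  have o [simp]: "A \<in> Ob C" "m \<in> Ar C" "Dom C m = A \<odot> A" "Cod C m = A"
    using assms(1) by (auto simp: nondegenerate_def semigroup_ob_def hom_def)
  have h [simp]: "f \<in> Ar C" "Dom C f = X" "Cod C f = A" "g \<in> Ar C" "Dom C g = X" "Cod C g = A" "X \<in> Ob C"
    using assms(2,3) hom_ob[OF assms(2)] by auto
  have r: "\<r> (A \<odot> A) \<cdot> minv (\<alpha> A A \<I>) = \<one> A \<otimes> \<r> A"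
    using runit_tensor[of A A, symmetric] by simp
  have *: "(m \<otimes> \<one> \<I>) \<cdot> minv (\<alpha> A A \<I>) \<cdot> (\<one> A \<otimes> (minv (\<r> A) \<cdot> k)) = minv (\<r> A) \<cdot> m \<cdot> (\<one> A \<otimes> k)"
    if [simp]: "k \<in> Ar C" "Dom C k = X" "Cod C k = A" for k
  proof (rule iso_cancel_left[of "\<r> A"])
    have "\<r> A \<cdot> (m \<otimes> \<one> \<I>) \<cdot> minv (\<alpha> A A \<I>) \<cdot> (\<one> A \<otimes> (minv (\<r> A) \<cdot> k))
        = (\<r> A \<cdot> (m \<otimes> \<one> \<I>)) \<cdot> minv (\<alpha> A A \<I>) \<cdot> (\<one> A \<otimes> (minv (\<r> A) \<cdot> k))" by simp
    also have "\<dots> = m \<cdot> (\<r> (A \<odot> A) \<cdot> minv (\<alpha> A A \<I>)) \<cdot> (\<one> A \<otimes> (minv (\<r> A) \<cdot> k))"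
      using runit_nat[of m] by simp
    also have "\<dots> = m \<cdot> (\<one> A \<otimes> \<r> A) \<cdot> (\<one> A \<otimes> (minv (\<r> A) \<cdot> k))"
      by (simp only: r)
    also have "\<dots> = m \<cdot> (\<one> A \<otimes> k)" by simp
    finally show "\<r> A \<cdot> (m \<otimes> \<one> \<I>) \<cdot> minv (\<alpha> A A \<I>) \<cdot> (\<one> A \<otimes> (minv (\<r> A) \<cdot> k))
        = \<r> A \<cdot> minv (\<r> A) \<cdot> m \<cdot> (\<one> A \<otimes> k)" by simp
  qed simp_all
  have "inj_on (\<lambda>g. (m \<otimes> \<one> \<I>) \<cdot> minv (\<alpha> A A \<I>) \<cdot> (\<one> A \<otimes> g)) (hom C X (A \<odot> \<I>))"
    using assms(1) by (simp add: nondegenerate_def)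
  then have "minv (\<r> A) \<cdot> f = minv (\<r> A) \<cdot> g"
    by (rule inj_onD) (use * assms(4) in \<open>simp_all add: hom_def\<close>)
  then show ?thesis
    by (rule iso_cancel_left[rotated -1]) simp_all
qed

end

section \<open>The inverse braiding and the opposite semigroup\<close>

context braided_monoidal_category
begin

lemma braid_inv_simps [simp]:
  assumes "X \<in> Ob C" "Y \<in> Ob C"
  shows "\<c>' X Y \<in> Ar C" "Dom C (\<c>' X Y) = X \<odot> Y" "Cod C (\<c>' X Y) = Y \<odot> X" "iso C (\<c>' X Y)"
    "\<c>' Y X \<cdot> \<c> X Y = \<one> (X \<odot> Y)" "\<c> Y X \<cdot> \<c>' X Y = \<one> (X \<odot> Y)"
  using assms by (simp_all add: braid_inv_def)

lemma braid_inv_nat: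
  assumes "f \<in> Ar C" "g \<in> Ar C"
  shows "\<c>' (Cod C f) (Cod C g) \<cdot> (f \<otimes> g) = (g \<otimes> f) \<cdot> \<c>' (Dom C f) (Dom C g)"
proof (rule iso_cancel_right[of "\<c> (Dom C g) (Dom C f)"])
  have "(\<c>' (Cod C f) (Cod C g) \<cdot> (f \<otimes> g)) \<cdot> \<c> (Dom C g) (Dom C f)
     = \<c>' (Cod C f) (Cod C g) \<cdot> \<c> (Cod C g) (Cod C f) \<cdot> (g \<otimes> f)"
    using braid_nat[of g f] assms by simp
  also have "\<dots> = ((g \<otimes> f) \<cdot> \<c>' (Dom C f) (Dom C g)) \<cdot> \<c> (Dom C g) (Dom C f)"
    using assms by (simp add: chain[OF braid_inv_simps(5)])
  finally show "(\<c>' (Cod C f) (Cod C g) \<cdot> (f \<otimes> g)) \<cdot> \<c> (Dom C g) (Dom C f)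
    = ((g \<otimes> f) \<cdot> \<c>' (Dom C f) (Dom C g)) \<cdot> \<c> (Dom C g) (Dom C f)" .
qed (use assms in simp_all)

text \<open>Inverting the braiding exchanges the hexagons: this is the inverse of
  \<open>hexagon2\<close>, solved for the braiding with a product.\<close>

lemma hexagon1_inv:
  assumes [simp]: "X \<in> Ob C" "Y \<in> Ob C" "Z \<in> Ob C"
  shows "\<c>' X (Y \<odot> Z) = minv (\<alpha> Y Z X) \<cdot> (\<one> Y \<otimes> \<c>' X Z) \<cdot> \<alpha> Y X Z \<cdot> (\<c>' X Y \<otimes> \<one> Z) \<cdot> minv (\<alpha> X Y Z)"
    (is "_ = ?r")
proof (rule iso_cancel_left[of "\<c> (Y \<odot> Z) X"])
  have "minv (\<alpha> X Y Z) \<cdot> \<c> (Y \<odot> Z) X \<cdot> minv (\<alpha> Y Z X) =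
      (\<c> Y X \<otimes> \<one> Z) \<cdot> minv (\<alpha> Y X Z) \<cdot> (\<one> Y \<otimes> \<c> Z X)"
    by (rule hexagon2) simp_all
  then have "\<alpha> X Y Z \<cdot> minv (\<alpha> X Y Z) \<cdot> \<c> (Y \<odot> Z) X \<cdot> minv (\<alpha> Y Z X)
      = \<alpha> X Y Z \<cdot> (\<c> Y X \<otimes> \<one> Z) \<cdot> minv (\<alpha> Y X Z) \<cdot> (\<one> Y \<otimes> \<c> Z X)"
    by (rule arg_cong)
  then have *: "\<c> (Y \<odot> Z) X \<cdot> minv (\<alpha> Y Z X)
      = \<alpha> X Y Z \<cdot> (\<c> Y X \<otimes> \<one> Z) \<cdot> minv (\<alpha> Y X Z) \<cdot> (\<one> Y \<otimes> \<c> Z X)"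
    by simp
  show "\<c> (Y \<odot> Z) X \<cdot> \<c>' X (Y \<odot> Z) = \<c> (Y \<odot> Z) X \<cdot> ?r"
    by (simp add: chain[OF *])
qed simp_all

lemma hexagon2_inv:
  assumes [simp]: "X \<in> Ob C" "Y \<in> Ob C" "Z \<in> Ob C"
  shows "\<c>' (X \<odot> Y) Z = \<alpha> Z X Y \<cdot> (\<c>' X Z \<otimes> \<one> Y) \<cdot> minv (\<alpha> X Z Y) \<cdot> (\<one> X \<otimes> \<c>' Y Z) \<cdot> \<alpha> X Y Z"
    (is "_ = ?r")
proof (rule iso_cancel_left[of "\<c> Z (X \<odot> Y)"])
  have "(\<alpha> X Y Z \<cdot> \<c> Z (X \<odot> Y) \<cdot> \<alpha> Z X Y) =
      (\<one> X \<otimes> \<c> Z Y) \<cdot> \<alpha> X Z Y \<cdot> (\<c> Z X \<otimes> \<one> Y)"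
    by (rule hexagon1) simp_all
  then have "minv (\<alpha> X Y Z) \<cdot> (\<alpha> X Y Z \<cdot> \<c> Z (X \<odot> Y) \<cdot> \<alpha> Z X Y) =
      minv (\<alpha> X Y Z) \<cdot> (\<one> X \<otimes> \<c> Z Y) \<cdot> \<alpha> X Z Y \<cdot> (\<c> Z X \<otimes> \<one> Y)"
    by (rule arg_cong)
  then have *: "\<c> Z (X \<odot> Y) \<cdot> \<alpha> Z X Y
      = minv (\<alpha> X Y Z) \<cdot> (\<one> X \<otimes> \<c> Z Y) \<cdot> \<alpha> X Z Y \<cdot> (\<c> Z X \<otimes> \<one> Y)"
    by simp
  show "\<c> Z (X \<odot> Y) \<cdot> \<c>' (X \<odot> Y) Z = \<c> Z (X \<odot> Y) \<cdot> ?r"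
    by (simp add: chain[OF *])
qed simp_all

text \<open>In both lemmas the two sides are the half twist on three strands; equating them is the
  Yang--Baxter equation.\<close>

lemma half_twist_left:
  assumes [simp]: "A \<in> Ob C" "Y \<in> Ob C"
  shows "(\<c>' A A \<otimes> \<one> Y) \<cdot> \<c>' Y (A \<odot> A) \<cdot> \<alpha> Y A A = minv (\<alpha> A A Y) \<cdot> (\<one> A \<otimes> \<c>' Y A) \<cdot> \<c>' (Y \<odot> A) A"
proof -
  have "minv (\<alpha> A A Y) \<cdot> (\<one> A \<otimes> \<c>' Y A) \<cdot> \<c>' (Y \<odot> A) A = minv (\<alpha> A A Y) \<cdot> \<c>' (A \<odot> Y) A \<cdot> (\<c>' Y A \<otimes> \<one> A)"
    using braid_inv_nat[of "\<c>' Y A" "\<one> A"] by simp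
  then show ?thesis
    by (simp add: hexagon1_inv hexagon2_inv)
qed

lemma half_twist_right:
  assumes [simp]: "A \<in> Ob C" "Y \<in> Ob C"
  shows "(\<one> Y \<otimes> \<c>' A A) \<cdot> \<c>' (A \<odot> A) Y \<cdot> minv (\<alpha> A A Y) = \<alpha> Y A A \<cdot> (\<c>' A Y \<otimes> \<one> A) \<cdot> \<c>' A (A \<odot> Y)"
proof -
  have "\<alpha> Y A A \<cdot> (\<c>' A Y \<otimes> \<one> A) \<cdot> \<c>' A (A \<odot> Y) = \<alpha> Y A A \<cdot> \<c>' A (Y \<odot> A) \<cdot> (\<one> A \<otimes> \<c>' A Y)"
    using braid_inv_nat[of "\<one> A" "\<c>' A Y"] by simp
  then show ?thesis
    by (simp add: hexagon1_inv hexagon2_inv)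
qed

text \<open>Up to the invertible braiding, multiplying on one side in the opposite semigroup is
  multiplying on the other side in \<open>A\<close>, so each injectivity condition follows from the
  opposite one.\<close>

lemma nondegenerate_op_mult:
  assumes "nondegenerate C A m"
  shows "nondegenerate C A (op_mult C A m)"
proof -
  have o [simp]: "A \<in> Ob C" "m \<in> Ar C" "Dom C m = A \<odot> A" "Cod C m = A"
    and ass: "m \<cdot> (m \<otimes> \<one> A) = m \<cdot> (\<one> A \<otimes> m) \<cdot> \<alpha> A A A"
    using assms by (auto simp: nondegenerate_def semigroup_ob_def hom_def)
  let ?n = "m \<cdot> \<c>' A A"
  \<comment> \<open>Naturality pulls the braiding through \<open>?n\<close>, and the half twist
    moves it onto \<open>f\<close>: the map \<open>f \<mapsto> 1n.f1\<close> becomes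
    \<open>g \<mapsto> m1.1g\<close> at \<open>g = \<c>' Y A \<cdot> f\<close>.\<close>
  have left: "\<c>' Y A \<cdot> (\<one> Y \<otimes> ?n) \<cdot> \<alpha> Y A A \<cdot> (f \<otimes> \<one> A)
      = (m \<otimes> \<one> Y) \<cdot> minv (\<alpha> A A Y) \<cdot> (\<one> A \<otimes> (\<c>' Y A \<cdot> f)) \<cdot> \<c>' X A"
    if [simp]: "f \<in> Ar C" "Dom C f = X" "Cod C f = Y \<odot> A" "X \<in> Ob C" "Y \<in> Ob C" for f X Y
  proof -
    have "\<c>' Y A \<cdot> (\<one> Y \<otimes> ?n) \<cdot> \<alpha> Y A A \<cdot> (f \<otimes> \<one> A) = (\<c>' Y A \<cdot> (\<one> Y \<otimes> ?n)) \<cdot> \<alpha> Y A A \<cdot> (f \<otimes> \<one> A)"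
      by simp
    also have "\<dots> = ((m \<otimes> \<one> Y) \<cdot> ((\<c>' A A \<otimes> \<one> Y) \<cdot> \<c>' Y (A \<odot> A) \<cdot> \<alpha> Y A A)) \<cdot> (f \<otimes> \<one> A)"
      using braid_inv_nat[of "\<one> Y" ?n] by simp
    also have "\<dots> = ((m \<otimes> \<one> Y) \<cdot> minv (\<alpha> A A Y) \<cdot> (\<one> A \<otimes> \<c>' Y A)) \<cdot> \<c>' (Y \<odot> A) A \<cdot> (f \<otimes> \<one> A)"
      by (subst half_twist_left) simp_all
    also have "\<dots> = (m \<otimes> \<one> Y) \<cdot> minv (\<alpha> A A Y) \<cdot> (\<one> A \<otimes> (\<c>' Y A \<cdot> f)) \<cdot> \<c>' X A"
      using braid_inv_nat[of f "\<one> A"] by simp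
    finally show ?thesis .
  qed
  have right: "\<c>' A Y \<cdot> (?n \<otimes> \<one> Y) \<cdot> minv (\<alpha> A A Y) \<cdot> (\<one> A \<otimes> g)
      = (\<one> Y \<otimes> m) \<cdot> \<alpha> Y A A \<cdot> ((\<c>' A Y \<cdot> g) \<otimes> \<one> A) \<cdot> \<c>' A X"
    if [simp]: "g \<in> Ar C" "Dom C g = X" "Cod C g = A \<odot> Y" "X \<in> Ob C" "Y \<in> Ob C" for g X Y
  proof -
    have "\<c>' A Y \<cdot> (?n \<otimes> \<one> Y) \<cdot> minv (\<alpha> A A Y) \<cdot> (\<one> A \<otimes> g) = (\<c>' A Y \<cdot> (?n \<otimes> \<one> Y)) \<cdot> minv (\<alpha> A A Y) \<cdot> (\<one> A \<otimes> g)"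
      by simp
    also have "\<dots> = ((\<one> Y \<otimes> m) \<cdot> ((\<one> Y \<otimes> \<c>' A A) \<cdot> \<c>' (A \<odot> A) Y \<cdot> minv (\<alpha> A A Y))) \<cdot> (\<one> A \<otimes> g)"
      using braid_inv_nat[of ?n "\<one> Y"] by simp
    also have "\<dots> = ((\<one> Y \<otimes> m) \<cdot> \<alpha> Y A A \<cdot> (\<c>' A Y \<otimes> \<one> A)) \<cdot> \<c>' A (A \<odot> Y) \<cdot> (\<one> A \<otimes> g)"
      by (subst half_twist_right) simp_all
    also have "\<dots> = (\<one> Y \<otimes> m) \<cdot> \<alpha> Y A A \<cdot> ((\<c>' A Y \<cdot> g) \<otimes> \<one> A) \<cdot> \<c>' A X"
      using braid_inv_nat[of "\<one> A" g] by simp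
    finally show ?thesis .
  qed
  have "?n \<cdot> (?n \<otimes> \<one> A) = ?n \<cdot> (\<one> A \<otimes> ?n) \<cdot> \<alpha> A A A"
  proof -
    have "?n \<cdot> (\<one> A \<otimes> ?n) \<cdot> \<alpha> A A A = m \<cdot> \<c>' A A \<cdot> (\<one> A \<otimes> ?n) \<cdot> \<alpha> A A A \<cdot> (\<one> (A \<odot> A) \<otimes> \<one> A)"
      by simp
    also have "\<dots> = (m \<cdot> (m \<otimes> \<one> A)) \<cdot> minv (\<alpha> A A A) \<cdot> (\<one> A \<otimes> \<c>' A A) \<cdot> \<c>' (A \<odot> A) A"
      \<comment> \<open>Associativity of the opposite product is the case of \<open>left\<close>
        where \<open>f\<close> is the identity of \<open>A \<odot> A\<close>.\<close>
      by (subst left[of "\<one> (A \<odot> A)" "A \<odot> A" A]) simp_all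
    also have "\<dots> = m \<cdot> (\<one> A \<otimes> ?n) \<cdot> \<c>' (A \<odot> A) A"
      by (simp add: ass)
    also have "\<dots> = ?n \<cdot> (?n \<otimes> \<one> A)"
      using braid_inv_nat[of ?n "\<one> A"] by simp
    finally show ?thesis ..
  qed
  then have "semigroup_ob C A ?n"
    by (simp add: semigroup_ob_def hom_def)
  moreover have "inj_on (\<lambda>f. (\<one> Y \<otimes> ?n) \<cdot> \<alpha> Y A A \<cdot> (f \<otimes> \<one> A)) (hom C X (Y \<odot> A))"
    if [simp]: "X \<in> Ob C" "Y \<in> Ob C" for X Y
  proof (rule inj_onI)
    fix f g assume "f \<in> hom C X (Y \<odot> A)" "g \<in> hom C X (Y \<odot> A)"
      and eq: "(\<one> Y \<otimes> ?n) \<cdot> \<alpha> Y A A \<cdot> (f \<otimes> \<one> A) = (\<one> Y \<otimes> ?n) \<cdot> \<alpha> Y A A \<cdot> (g \<otimes> \<one> A)"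
    then have h [simp]: "f \<in> Ar C" "Dom C f = X" "Cod C f = Y \<odot> A" "g \<in> Ar C" "Dom C g = X" "Cod C g = Y \<odot> A"
      by auto
    have "((m \<otimes> \<one> Y) \<cdot> minv (\<alpha> A A Y) \<cdot> (\<one> A \<otimes> (\<c>' Y A \<cdot> f))) \<cdot> \<c>' X A
        = ((m \<otimes> \<one> Y) \<cdot> minv (\<alpha> A A Y) \<cdot> (\<one> A \<otimes> (\<c>' Y A \<cdot> g))) \<cdot> \<c>' X A"
      using left[of f X Y] left[of g X Y] eq by simp
    then have *: "(m \<otimes> \<one> Y) \<cdot> minv (\<alpha> A A Y) \<cdot> (\<one> A \<otimes> (\<c>' Y A \<cdot> f))
        = (m \<otimes> \<one> Y) \<cdot> minv (\<alpha> A A Y) \<cdot> (\<one> A \<otimes> (\<c>' Y A \<cdot> g))"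
      by (rule iso_cancel_right[rotated -1]) simp_all
    have "inj_on (\<lambda>g. (m \<otimes> \<one> Y) \<cdot> minv (\<alpha> A A Y) \<cdot> (\<one> A \<otimes> g)) (hom C X (A \<odot> Y))"
      using assms by (simp add: nondegenerate_def)
    then have "\<c>' Y A \<cdot> f = \<c>' Y A \<cdot> g"
      using * by (rule inj_onD) (simp_all add: hom_def)
    then show "f = g"
      by (rule iso_cancel_left[rotated -1]) simp_all
  qed
  moreover have "inj_on (\<lambda>g. (?n \<otimes> \<one> Y) \<cdot> minv (\<alpha> A A Y) \<cdot> (\<one> A \<otimes> g)) (hom C X (A \<odot> Y))"
    if [simp]: "X \<in> Ob C" "Y \<in> Ob C" for X Y
  proof (rule inj_onI)
    fix f g assume "f \<in> hom C X (A \<odot> Y)" "g \<in> hom C X (A \<odot> Y)"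
      and eq: "(?n \<otimes> \<one> Y) \<cdot> minv (\<alpha> A A Y) \<cdot> (\<one> A \<otimes> f) = (?n \<otimes> \<one> Y) \<cdot> minv (\<alpha> A A Y) \<cdot> (\<one> A \<otimes> g)"
    then have h [simp]: "f \<in> Ar C" "Dom C f = X" "Cod C f = A \<odot> Y" "g \<in> Ar C" "Dom C g = X" "Cod C g = A \<odot> Y"
      by auto
    have "((\<one> Y \<otimes> m) \<cdot> \<alpha> Y A A \<cdot> ((\<c>' A Y \<cdot> f) \<otimes> \<one> A)) \<cdot> \<c>' A X
        = ((\<one> Y \<otimes> m) \<cdot> \<alpha> Y A A \<cdot> ((\<c>' A Y \<cdot> g) \<otimes> \<one> A)) \<cdot> \<c>' A X"
      using right[of f X Y] right[of g X Y] eq by simp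
    then have *: "(\<one> Y \<otimes> m) \<cdot> \<alpha> Y A A \<cdot> ((\<c>' A Y \<cdot> f) \<otimes> \<one> A)
        = (\<one> Y \<otimes> m) \<cdot> \<alpha> Y A A \<cdot> ((\<c>' A Y \<cdot> g) \<otimes> \<one> A)"
      by (rule iso_cancel_right[rotated -1]) simp_all
    have "inj_on (\<lambda>f. (\<one> Y \<otimes> m) \<cdot> \<alpha> Y A A \<cdot> (f \<otimes> \<one> A)) (hom C X (Y \<odot> A))"
      using assms by (simp add: nondegenerate_def)
    then have "\<c>' A Y \<cdot> f = \<c>' A Y \<cdot> g"
      using * by (rule inj_onD) (simp_all add: hom_def)
    then show "f = g"
      by (rule iso_cancel_left[rotated -1]) simp_all
  qed
  ultimately show ?thesis
    by (simp add: nondegenerate_def op_mult_def)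
qed

text \<open>By naturality the braiding carries the counit to the other strand, leaving a braiding
  with \<open>\<I>\<close> that the unit constraints absorb.\<close>

lemma counit_braid:
  assumes "A \<in> Ob C" "e \<in> Ar C" "Dom C e = A" "Cod C e = \<I>"
  shows "counit_left C A e \<cdot> \<c> A A = counit_right C A e"
    "counit_right C A e \<cdot> \<c> A A = counit_left C A e"
  using assms braid_nat[of "\<one> A" e, symmetric] braid_nat[of e "\<one> A", symmetric]
  by (simp_all add: counit_left_def counit_right_def chain[OF lunit_braid] chain[OF runit_braid])

end

section \<open>Construction of the antipode\<close>

text \<open>Only the braiding at \<open>A,A\<close> enters, so it is replaced by mutually inverse \<open>c\<close> and \<open>c'\<close>. This makes
  the assumptions invariant under exchanging \<open>(t1,t2,c)\<close> with \<open>(t3,t4,c')\<close>, that is, under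
  passing to the opposite semigroup and the inverse braiding.\<close>

locale antipode_data = monoidal_category C + regular_epi_class C Q
  for C :: "('o, 'm, 'x) monoidal_data_scheme" (structure) and Q +
  fixes A :: 'o and m c c' t1 t2 t3 t4 e :: 'm
  assumes e_mem: "e \<in> Q"
    and ob [simp]: "A \<in> Ob C"
    and e_hom: "e \<in> hom C A \<I>"
    and c_hom: "c \<in> hom C (A \<odot> A) (A \<odot> A)"
    and c_inv: "inverse_pair C c c'"
    and t_hom: "t1 \<in> hom C (A \<odot> A) (A \<odot> A)" "t2 \<in> hom C (A \<odot> A) (A \<odot> A)"
      "t3 \<in> hom C (A \<odot> A) (A \<odot> A)" "t4 \<in> hom C (A \<odot> A) (A \<odot> A)"
    and t_iso [simp]: "iso C t1" "iso C t2" "iso C t3" "iso C t4"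
    and counit_c: "counit_left C A e \<cdot> c = counit_right C A e" "counit_right C A e \<cdot> c = counit_left C A e"
    and counit_t: "counit_right C A e \<cdot> t1 = counit_right C A e" "counit_left C A e \<cdot> t2 = counit_left C A e"
      "counit_right C A e \<cdot> t3 = counit_right C A e" "counit_left C A e \<cdot> t4 = counit_left C A e"
    and m_t: "counit_left C A e \<cdot> t1 = m" "counit_right C A e \<cdot> t2 = m"
      "counit_left C A e \<cdot> t3 = m \<cdot> c'" "counit_right C A e \<cdot> t4 = m \<cdot> c'"
    and fusion: "on12 C A t1 \<cdot> on12 C A c' \<cdot> on23 C A t1 \<cdot> on12 C A c \<cdot> on23 C A t1
        = on23 C A t1 \<cdot> on12 C A t1"
      "on12 C A t3 \<cdot> on12 C A c \<cdot> on23 C A t3 \<cdot> on12 C A c' \<cdot> on23 C A t3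
        = on23 C A t3 \<cdot> on12 C A t3"
    and commute: "on23 C A t1 \<cdot> on12 C A t2 = on12 C A t2 \<cdot> on23 C A t1"
      "on23 C A t3 \<cdot> on12 C A t4 = on12 C A t4 \<cdot> on23 C A t3"
      "on12 C A t4 \<cdot> on23 C A t1 = on23 C A t1 \<cdot> on12 C A t4"
      "on23 C A t3 \<cdot> on12 C A t2 = on12 C A t2 \<cdot> on23 C A t3"
    and nondeg: "nondegenerate C A m" "nondegenerate C A (m \<cdot> c')"
begin

section \<open>Typing rules and the symmetry between the two antipodes\<close>

abbreviation "cl \<equiv> counit_left C A e"
abbreviation "cr \<equiv> counit_right C A e"
abbreviation "s1 \<equiv> cl \<cdot> minv t1"
abbreviation "s2 \<equiv> cr \<cdot> minv t2"

lemma c'_simps [simp]: "c' \<in> Ar C" "Dom C c' = A \<odot> A" "Cod C c' = A \<odot> A"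
    "c' \<cdot> c = \<one> (A \<odot> A)" "c \<cdot> c' = \<one> (A \<odot> A)"
  and hom_simps [simp]: "c \<in> Ar C" "Dom C c = A \<odot> A" "Cod C c = A \<odot> A"
    "t1 \<in> Ar C" "Dom C t1 = A \<odot> A" "Cod C t1 = A \<odot> A"
    "t2 \<in> Ar C" "Dom C t2 = A \<odot> A" "Cod C t2 = A \<odot> A"
    "t3 \<in> Ar C" "Dom C t3 = A \<odot> A" "Cod C t3 = A \<odot> A"
    "t4 \<in> Ar C" "Dom C t4 = A \<odot> A" "Cod C t4 = A \<odot> A"
    "e \<in> Ar C" "Dom C e = A" "Cod C e = \<I>"
  using inverse_pairD[OF c_inv] c_hom t_hom e_hom by (auto simp: hom_def)

lemma m_simps [simp]: "m \<in> Ar C" "Dom C m = A \<odot> A" "Cod C m = A"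
  and mult_assoc: "m \<cdot> on12 C A m = m \<cdot> act23 C A m"
  using nondeg(1) by (auto simp: nondegenerate_def semigroup_ob_def hom_def on12_def act23_def)

lemma counit_c': "cl \<cdot> c' = cr" "cr \<cdot> c' = cl"
proof -
  have "(cr \<cdot> c) \<cdot> c' = cr" "(cl \<cdot> c) \<cdot> c' = cl" by simp_all
  then show "cl \<cdot> c' = cr" "cr \<cdot> c' = cl" by (simp_all only: counit_c)
qed

text \<open>Whatever is proved for \<open>s1\<close>, \<open>s2\<close> and \<open>m\<close> thereby
  holds for the antipode built from \<open>t3\<close>, \<open>t4\<close>, with target the opposite
  semigroup.\<close>

lemma swap: "antipode_data C Q A (m \<cdot> c') c' c t3 t4 t1 t2 e"
proof -
  have "m \<cdot> c' \<cdot> c = m" by simp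
  then show ?thesis
    using inverse_pair_sym[OF c_inv] e_mem
    by unfold_locales (simp_all add: hom_def counit_c' counit_t m_t fusion commute nondeg)
qed

section \<open>Moving counits past operators\<close>

lemma act23_counit: "act23 C A cl = on12 C A cr"
  by (simp add: act23_counit_left)

lemma counit_act23:
  assumes "f \<in> Ar C" "Dom C f = A \<odot> A" "Cod C f = A"
  shows "cl \<cdot> act23 C A f = f \<cdot> on12 C A cl"
  using counit_left_act23[of A e f] assms by (simp add: counit_left_def)

text \<open>\<open>on12 C A cl\<close> is the erasure of the first strand, by
  \<open>counit_left_act23\<close> at the identity; an operator on the other two strands passes
  through it.\<close>

lemma on12_counit_left_on23:
  assumes "f \<in> Ar C" "Dom C f = A \<odot> A" "Cod C f = A \<odot> A"
  shows "on12 C A cl \<cdot> on23 C A f = f \<cdot> on12 C A cl"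
proof -
  have *: "\<l> (A \<odot> A) \<cdot> (e \<otimes> \<one> (A \<odot> A)) \<cdot> act23 C A k = k \<cdot> on12 C A cl"
    if "k \<in> Ar C" "Dom C k = A \<odot> A" "Cod C k = A \<odot> A" for k
    using counit_left_act23[of A e k] that by simp
  have "on12 C A cl = \<l> (A \<odot> A) \<cdot> (e \<otimes> \<one> (A \<odot> A)) \<cdot> act23 C A (\<one> (A \<odot> A))"
    using *[of "\<one> (A \<odot> A)"] by simp
  then have "on12 C A cl \<cdot> on23 C A f = \<l> (A \<odot> A) \<cdot> (e \<otimes> \<one> (A \<odot> A)) \<cdot> act23 C A f"
    using assms by (simp add: act23_on23)
  then show ?thesis
    using * assms by simp
qed

lemma on12_counit_right_on23:
  assumes "f \<in> Ar C" "Dom C f = A \<odot> A" "Cod C f = A \<odot> A"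
  shows "on12 C A cr \<cdot> on23 C A f = act23 C A (cl \<cdot> f)"
  using assms by (simp add: act23_counit[symmetric] act23_on23)

text \<open>\<open>fuse\<close> merges operators acting on the same strands, \<open>slide\<close>
  moves a counit past an operator, and \<open>counits\<close> evaluates a counit on a structure
  morphism.\<close>

lemmas fuse = on12_comp chain[OF on12_comp] act23_on23 chain[OF act23_on23]
lemmas slide = on12_counit_left_on23 chain[OF on12_counit_left_on23]
  on12_counit_right_on23 chain[OF on12_counit_right_on23]
  counit_act23 chain[OF counit_act23] act23_counit
lemmas counits = counit_c counit_c' counit_t m_t
  counit_c[THEN chain] counit_c'[THEN chain] counit_t[THEN chain] m_t[THEN chain]

section \<open>Linearity and anti-multiplicativity of the antipode\<close>

text \<open>Right linearity of \<open>t1\<close>, by the counit in the middle strand of the fusion equation.\<close>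

lemma t1_act23_mult: "t1 \<cdot> act23 C A m = act23 C A m \<cdot> on12 C A t1"
proof -
  have "on12 C A cr \<cdot> on12 C A t1 \<cdot> on12 C A c' \<cdot> on23 C A t1 \<cdot> on12 C A c \<cdot> on23 C A t1
      = on12 C A cr \<cdot> on23 C A t1 \<cdot> on12 C A t1"
    by (simp only: fusion)
  then show ?thesis
    by (simp add: fuse slide counits)
qed

text \<open>Multiplicativity of the comultiplication, by the counit in the first strand of the fusion equation.\<close>

lemma t1_on12_mult:
  "t1 \<cdot> on12 C A m = on12 C A m \<cdot> on12 C A c' \<cdot> on23 C A t1 \<cdot> on12 C A c \<cdot> on23 C A t1"
proof -
  have "on12 C A cl \<cdot> on12 C A t1 \<cdot> on12 C A c' \<cdot> on23 C A t1 \<cdot> on12 C A c \<cdot> on23 C A t1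
      = on12 C A cl \<cdot> on23 C A t1 \<cdot> on12 C A t1"
    by (simp only: fusion)
  then show ?thesis
    by (simp add: fuse slide counits)
qed

text \<open>In elements, \<open>S(a)(bc) = (S(a)b)c\<close>. Right linearity of \<open>t1\<close>
  passes to its inverse.\<close>

lemma s1_act23_mult: "s1 \<cdot> act23 C A m = m \<cdot> on12 C A s1"
proof (rule iso_cancel_right[of "on12 C A t1"])
  have "(s1 \<cdot> act23 C A m) \<cdot> on12 C A t1 = s1 \<cdot> t1 \<cdot> act23 C A m"
    by (simp add: t1_act23_mult)
  then show "(s1 \<cdot> act23 C A m) \<cdot> on12 C A t1 = (m \<cdot> on12 C A s1) \<cdot> on12 C A t1"
    by (simp add: fuse slide)
qed (simp_all add: iso_on12)

text \<open>In elements, \<open>S(ba)c = S(a)(S(b)c)\<close>. Precomposed with the invertible tail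
  of the fusion equation, both sides become \<open>\<epsilon>(a)\<epsilon>(b)c\<close>.\<close>

lemma s1_on12_op_mult: "s1 \<cdot> on12 C A (m \<cdot> c') = s1 \<cdot> act23 C A s1"
proof (rule iso_cancel_right[of "on23 C A t1 \<cdot> on12 C A c \<cdot> on23 C A t1"])
  have "(s1 \<cdot> on12 C A (m \<cdot> c')) \<cdot> on23 C A t1 \<cdot> on12 C A c \<cdot> on23 C A t1
      = s1 \<cdot> t1 \<cdot> on12 C A m"
    by (simp add: t1_on12_mult fuse)
  also have "\<dots> = cl \<cdot> on12 C A (cl \<cdot> t1)"
    by (simp add: m_t)
  also have "\<dots> = cl \<cdot> on12 C A cl \<cdot> on12 C A t1"
    by (simp add: fuse)
  \<comment> \<open>This and the next step say that the counit is multiplicative: the inner counit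
    is moved to the second strand, where it absorbs \<open>t1\<close>.\<close>
  also have "\<dots> = cl \<cdot> on12 C A cr \<cdot> on12 C A t1"
    by (simp add: chain[OF counit_left_on12_counit])
  also have "\<dots> = cl \<cdot> on12 C A cr"
    by (simp add: fuse counits)
  also have "\<dots> = (s1 \<cdot> act23 C A s1) \<cdot> on23 C A t1 \<cdot> on12 C A c \<cdot> on23 C A t1"
  proof -
    have "(s1 \<cdot> act23 C A s1) \<cdot> on23 C A t1 \<cdot> on12 C A c \<cdot> on23 C A t1
      = s1 \<cdot> on12 C A cl \<cdot> on23 C A t1"
      by (simp add: fuse slide counits)
    also have "\<dots> = s1 \<cdot> t1 \<cdot> on12 C A cl"
      by (simp only: on12_counit_left_on23 hom_simps)
    also have "\<dots> = cl \<cdot> on12 C A cr"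
      by (simp add: counit_left_on12_counit)
    finally show ?thesis by simp
  qed
  finally show "(s1 \<cdot> on12 C A (m \<cdot> c')) \<cdot> on23 C A t1 \<cdot> on12 C A c \<cdot> on23 C A t1
    = (s1 \<cdot> act23 C A s1) \<cdot> on23 C A t1 \<cdot> on12 C A c \<cdot> on23 C A t1" .
next
  show "iso C (on23 C A t1 \<cdot> on12 C A c \<cdot> on23 C A t1)"
    using isoI[OF c_inv] by (simp add: iso_on12 iso_on23)
qed simp_all

text \<open>In elements, \<open>a(S(b)c) = (aS(b))c\<close>. Precomposed with the commuting
  \<open>t1\<close> and \<open>t2\<close>, the two sides become the two bracketings of the triple
  product.\<close>

lemma mult_act23_s1: "m \<cdot> act23 C A s1 = m \<cdot> on12 C A s2"
proof (rule iso_cancel_right[of "on23 C A t1 \<cdot> on12 C A t2"])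
  have "(m \<cdot> act23 C A s1) \<cdot> on23 C A t1 \<cdot> on12 C A t2 = m \<cdot> on12 C A m"
    by (simp add: fuse slide counits)
  also have "\<dots> = (m \<cdot> on12 C A s2) \<cdot> on12 C A t2 \<cdot> on23 C A t1"
    by (simp add: fuse slide counits mult_assoc)
  finally show "(m \<cdot> act23 C A s1) \<cdot> on23 C A t1 \<cdot> on12 C A t2 = (m \<cdot> on12 C A s2) \<cdot> on23 C A t1 \<cdot> on12 C A t2"
    by (simp only: commute)
qed (simp_all add: iso_on12 iso_on23)

lemma M_morphism_antipode: "M_morphism C A A m (s1, s2)"
  using mult_act23_s1 nondeg by (simp add: M_morphism_def act23_def on12_def hom_def)

text \<open>In elements, \<open>S(b\<^sub>1 a)(b\<^sub>2 c) = S(a)S(b\<^sub>1)b\<^sub>2 c =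
  \<epsilon>(b)S(a)c\<close>.\<close>

lemma mult_s1_t4: "m \<cdot> on12 C A (s1 \<cdot> t4) = s1 \<cdot> on12 C A cr"
proof -
  have "m \<cdot> on12 C A (s1 \<cdot> t4) = (m \<cdot> on12 C A s1) \<cdot> on12 C A t4"
    by (simp add: fuse)
  also have "\<dots> = s1 \<cdot> act23 C A (cl \<cdot> t1) \<cdot> on12 C A t4"
    by (simp add: s1_act23_mult[symmetric] m_t)
  also have "\<dots> = s1 \<cdot> on12 C A cr \<cdot> on23 C A t1 \<cdot> on12 C A t4"
    by (simp add: slide)
  \<comment> \<open>Commuting \<open>t4\<close> with \<open>t1\<close> lets the counit of the middle
    strand act on \<open>t4\<close>, where it yields the opposite product to which
    anti-multiplicativity applies.\<close>
  also have "\<dots> = s1 \<cdot> on12 C A cr \<cdot> on12 C A t4 \<cdot> on23 C A t1"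
    by (simp only: commute)
  also have "\<dots> = (s1 \<cdot> on12 C A (m \<cdot> c')) \<cdot> on23 C A t1"
    by (simp add: fuse counits)
  also have "\<dots> = s1 \<cdot> act23 C A s1 \<cdot> on23 C A t1"
    by (simp add: s1_on12_op_mult)
  also have "\<dots> = s1 \<cdot> on12 C A cr"
    by (simp add: fuse slide)
  finally show ?thesis .
qed

section \<open>Factorization of the antipode through the counit\<close>

lemma on12_counit_right_mem: "on12 C A cr \<in> Q"
proof -
  have 1: "\<one> A \<in> Q" "\<r> A \<in> Q"
    by (simp_all add: iso_mem)
  then have "cr \<in> Q"
    unfolding counit_right_def
    by (intro comp_mem[of _ _ "A \<odot> A" "A \<odot> \<I>" A]) (simp_all add: tensor_mem e_mem hom_def)
  then show "on12 C A cr \<in> Q"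
    using 1 by (simp add: on12_def tensor_mem)
qed

lemma s1_t4_factors:
  obtains z where "z \<in> hom C A A" "s1 \<cdot> t4 = z \<cdot> cr"
proof -
  \<comment> \<open>The stable pair is chosen so that \<open>\<one> A \<otimes> e\<close> is again a
    coequalizer.\<close>
  obtain f g where "tensor_stable_coequalizer C f g e"
    using stable_coequalizer[OF e_mem] by auto
  then have "coequalizer C f g e" and co: "coequalizer C (\<one> A \<otimes> f) (\<one> A \<otimes> g) (\<one> A \<otimes> e)"
    by (simp_all add: tensor_stable_coequalizer_def)
  then obtain X Y Z where fg: "f \<in> hom C X Y" "g \<in> hom C X Y" "e \<in> hom C Y Z" "e \<cdot> f = e \<cdot> g"
    unfolding coequalizer_def by auto
  have [simp]: "f \<in> Ar C" "Dom C f = X" "Cod C f = A" "g \<in> Ar C" "Dom C g = X" "Cod C g = A" "X \<in> Ob C"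
    using fg hom_ob[OF fg(1)] e_hom by (auto simp: hom_def)
  have *: "m \<cdot> (((s1 \<cdot> t4) \<cdot> (\<one> A \<otimes> k)) \<otimes> \<one> A) = s1 \<cdot> ((\<r> A \<cdot> (\<one> A \<otimes> (e \<cdot> k))) \<otimes> \<one> A)"
    if [simp]: "k \<in> Ar C" "Dom C k = X" "Cod C k = A" for k
  proof -
    have "m \<cdot> (((s1 \<cdot> t4) \<cdot> (\<one> A \<otimes> k)) \<otimes> \<one> A) = (m \<cdot> on12 C A (s1 \<cdot> t4)) \<cdot> ((\<one> A \<otimes> k) \<otimes> \<one> A)"
      by (simp add: on12_def)
    also have "\<dots> = s1 \<cdot> ((\<r> A \<cdot> (\<one> A \<otimes> (e \<cdot> k))) \<otimes> \<one> A)"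
      unfolding mult_s1_t4 by (simp add: on12_def counit_right_def)
    finally show ?thesis .
  qed
  \<comment> \<open>By \<open>*\<close>, after multiplication by a further factor only
    \<open>e \<cdot> k\<close> matters, and \<open>e\<close> does not distinguish \<open>f\<close>
    from \<open>g\<close>.\<close>
  have "(s1 \<cdot> t4) \<cdot> (\<one> A \<otimes> f) = (s1 \<cdot> t4) \<cdot> (\<one> A \<otimes> g)"
    by (rule nondegenerate_left_cancel[OF nondeg(1), of _ "A \<odot> X"])
      (use *[of f] *[of g] fg(4) in \<open>simp_all add: hom_def\<close>)
  then obtain k where k: "k \<in> hom C (A \<odot> \<I>) A" "k \<cdot> (\<one> A \<otimes> e) = s1 \<cdot> t4"
    by (rule coequalizer_factor[OF co, rotated, where W = A]) (simp_all add: hom_def)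
  then have [simp]: "k \<in> Ar C" "Dom C k = A \<odot> \<I>" "Cod C k = A"
    by auto
  show ?thesis
    by (rule that[of "k \<cdot> minv (\<r> A)"]) (use k in \<open>simp_all add: hom_def counit_right_def\<close>)
qed

lemma antipode_factors: "\<exists>z \<in> hom C A A. (s1, s2) = sharp C A m z"
proof -
  obtain z where z: "z \<in> hom C A A" "s1 \<cdot> t4 = z \<cdot> cr"
    by (rule s1_t4_factors)
  then have [simp]: "z \<in> Ar C" "Dom C z = A" "Cod C z = A"
    by auto
  have s1: "m \<cdot> (z \<otimes> \<one> A) = s1"
  proof (rule regular_epi_cancel[OF regular_epi[OF on12_counit_right_mem]])
    \<comment> \<open>By the choice of \<open>z\<close>, this is \<open>mult_s1_t4\<close> read
      again; the counit on the middle strand is then cancelled as a regular epimorphism.\<close>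
    show "(m \<cdot> (z \<otimes> \<one> A)) \<cdot> on12 C A cr = s1 \<cdot> on12 C A cr"
      using mult_s1_t4 unfolding z(2) by (simp add: on12_def)
  qed (simp_all add: hom_def)
  \<comment> \<open>By non-degeneracy the first component of an M-morphism determines the
    second.\<close>
  have "s2 = m \<cdot> (\<one> A \<otimes> z)"
  proof (rule nondegenerate_left_cancel[OF nondeg(1)])
    have "m \<cdot> (s2 \<otimes> \<one> A) = m \<cdot> act23 C A (m \<cdot> (z \<otimes> \<one> A))"
      unfolding s1 by (simp only: mult_act23_s1) (simp add: on12_def)
    also have "\<dots> = (m \<cdot> act23 C A m) \<cdot> ((\<one> A \<otimes> z) \<otimes> \<one> A)"
      by (simp add: act23_tensor) (simp add: act23_def)
    also have "\<dots> = m \<cdot> ((m \<cdot> (\<one> A \<otimes> z)) \<otimes> \<one> A)"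
      by (simp add: mult_assoc[symmetric]) (simp add: on12_def)
    finally show "m \<cdot> (s2 \<otimes> \<one> A) = m \<cdot> ((m \<cdot> (\<one> A \<otimes> z)) \<otimes> \<one> A)" .
  qed (simp_all add: hom_def)
  then show ?thesis
    using z(1) s1 by (intro bexI[of _ z]) (simp_all add: sharp_def)
qed

lemma antipode_factors_unique:
  "\<exists>!z. z \<in> hom C A A \<and> (s1, s2) = sharp C A m z"
proof -
  have "z = z'" if "z \<in> hom C A A" "z' \<in> hom C A A" "sharp C A m z = sharp C A m z'" for z z'
    using that nondegenerate_left_cancel[OF nondeg(1)] by (simp add: sharp_def)
  then show ?thesis
    using antipode_factors by metis
qed

section \<open>The inducing morphism, and the composite of the two antipodes\<close>

context
  fixes z
  assumes z: "z \<in> hom C A A" and sharp_z: "(s1, s2) = sharp C A m z"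
begin

lemma z_simps: "z \<in> Ar C" "Dom C z = A" "Cod C z = A"
  using z by auto

lemma mult_z: "m \<cdot> (z \<otimes> \<one> A) = s1" "m \<cdot> (\<one> A \<otimes> z) = s2"
  using sharp_z by (simp_all add: sharp_def)

text \<open>Anti-multiplicativity of \<open>s1\<close> with its last factor cancelled.\<close>

lemma z_op_mult: "z \<cdot> m \<cdot> c' = m \<cdot> (z \<otimes> z)"
proof (rule nondegenerate_left_cancel[OF nondeg(1)])
  note z_simps [simp]
  have "m \<cdot> ((z \<cdot> m \<cdot> c') \<otimes> \<one> A) = (m \<cdot> (z \<otimes> \<one> A)) \<cdot> on12 C A (m \<cdot> c')"
    by (simp add: on12_def)
  also have "\<dots> = (m \<cdot> (z \<otimes> \<one> A)) \<cdot> act23 C A (m \<cdot> (z \<otimes> \<one> A))"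
    unfolding mult_z by (rule s1_on12_op_mult)
  also have "\<dots> = (m \<cdot> act23 C A m) \<cdot> ((z \<otimes> z) \<otimes> \<one> A)"
    by (simp add: act23_tensor) (simp add: act23_def)
  also have "\<dots> = m \<cdot> ((m \<cdot> (z \<otimes> z)) \<otimes> \<one> A)"
    by (simp add: mult_assoc[symmetric]) (simp add: on12_def)
  finally show "m \<cdot> ((z \<cdot> m \<cdot> c') \<otimes> \<one> A) = m \<cdot> ((m \<cdot> (z \<otimes> z)) \<otimes> \<one> A)" .
qed (simp_all add: hom_def z_simps)

text \<open>Since \<open>s2\<close> multiplies on the right by a value of \<open>z\<close>, left
  linearity is associativity.\<close>

lemma mult_act23_s2: "m \<cdot> act23 C A s2 = s2 \<cdot> on12 C A m"
proof -
  note z_simps [simp]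
  \<comment> \<open>\<open>tensor_ident\<close> is switched off because merging the two identities
    would destroy the shape that \<open>act23_tensor\<close> matches.\<close>
  have "m \<cdot> act23 C A (m \<cdot> (\<one> A \<otimes> z)) = (m \<cdot> act23 C A m) \<cdot> ((\<one> A \<otimes> \<one> A) \<otimes> z)"
    by (subst assoc_simp) (simp_all add: act23_tensor act23_comp del: tensor_ident, simp add: act23_def)
  also have "\<dots> = (m \<cdot> (\<one> A \<otimes> z)) \<cdot> on12 C A m"
    by (simp add: mult_assoc[symmetric]) (simp add: on12_def)
  finally show ?thesis
    unfolding mult_z .
qed

lemma s2_act23_op_mult: "s2 \<cdot> act23 C A (m \<cdot> c') = s2 \<cdot> on12 C A s2"
proof -
  note z_simps [simp]
  have "(m \<cdot> (\<one> A \<otimes> z)) \<cdot> act23 C A (m \<cdot> c') = m \<cdot> act23 C A (z \<cdot> m \<cdot> c')"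
    by (simp add: act23_def)
  also have "\<dots> = (m \<cdot> act23 C A m) \<cdot> ((\<one> A \<otimes> z) \<otimes> z)"
    unfolding z_op_mult by (simp add: act23_tensor) (simp add: act23_def)
  also have "\<dots> = (m \<cdot> (\<one> A \<otimes> z)) \<cdot> on12 C A (m \<cdot> (\<one> A \<otimes> z))"
    by (simp add: mult_assoc[symmetric]) (simp add: on12_def)
  finally show ?thesis
    unfolding mult_z .
qed

text \<open>In elements, \<open>a\<^sub>1 S(b a\<^sub>2) = \<epsilon>(a)S(b)\<close>: the mirror
  image of \<open>mult_s1_t4\<close>, tested by multiplying on the left and commuting
  \<open>t2\<close> with \<open>t3\<close>.\<close>

lemma s2_t3: "s2 \<cdot> t3 = z \<cdot> cl"
proof (rule nondegenerate_right_cancel[OF nondeg(1)])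
  note z_simps [simp]
  have "m \<cdot> act23 C A (s2 \<cdot> t3) = (m \<cdot> act23 C A s2) \<cdot> on23 C A t3"
    by (simp add: fuse)
  also have "\<dots> = s2 \<cdot> on12 C A (cr \<cdot> t2) \<cdot> on23 C A t3"
    by (simp add: mult_act23_s2 m_t)
  also have "\<dots> = s2 \<cdot> on12 C A cr \<cdot> on12 C A t2 \<cdot> on23 C A t3"
    by (simp add: fuse)
  also have "\<dots> = s2 \<cdot> on12 C A cr \<cdot> on23 C A t3 \<cdot> on12 C A t2"
    by (simp only: commute)
  also have "\<dots> = (s2 \<cdot> act23 C A (m \<cdot> c')) \<cdot> on12 C A t2"
    by (simp add: slide counits)
  also have "\<dots> = s2 \<cdot> act23 C A cl"
    by (simp add: s2_act23_op_mult fuse slide)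
  also have "\<dots> = m \<cdot> act23 C A (z \<cdot> cl)"
    unfolding mult_z[symmetric] by (simp add: act23_def)
  finally have "(m \<cdot> (\<one> A \<otimes> (s2 \<cdot> t3))) \<cdot> \<alpha> A A A = (m \<cdot> (\<one> A \<otimes> (z \<cdot> cl))) \<cdot> \<alpha> A A A"
    by (simp add: act23_def)
  then show "m \<cdot> (\<one> A \<otimes> (s2 \<cdot> t3)) = m \<cdot> (\<one> A \<otimes> (z \<cdot> cl))"
    by (rule iso_cancel_right[rotated -1]) simp_all
qed (simp_all add: hom_def z_simps)

text \<open>Both \<open>a\<^sub>1 S(b a\<^sub>2)c\<close> and
  \<open>S(S'(a\<^sub>1)) S(b a\<^sub>2)c\<close> equal \<open>\<epsilon>(a)S(b)c\<close>. The
  hypothesis on \<open>z'\<close> is needed only as the first component of the other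
  antipode.\<close>

lemma right_inverse:
  assumes z': "z' \<in> hom C A A" and s': "m \<cdot> c' \<cdot> (z' \<otimes> \<one> A) = cl \<cdot> minv t3"
  shows "z \<cdot> z' = \<one> A"
proof (rule nondegenerate_left_cancel[OF nondeg(1)])
  note z_simps [simp]
  have [simp]: "z' \<in> Ar C" "Dom C z' = A" "Cod C z' = A"
    using z' by auto
  have "(m \<cdot> ((z \<cdot> z') \<otimes> \<one> A) \<cdot> act23 C A s1) \<cdot> on12 C A t3
      = (m \<cdot> (z \<otimes> \<one> A)) \<cdot> (z' \<otimes> \<one> A) \<cdot> act23 C A s1 \<cdot> on12 C A t3"
    by simp
  also have "\<dots> = (s1 \<cdot> act23 C A s1) \<cdot> on12 C A (z' \<otimes> \<one> A) \<cdot> on12 C A t3"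
  proof -
    have *: "(z' \<otimes> \<one> A) \<cdot> act23 C A s1 = act23 C A s1 \<cdot> on12 C A (z' \<otimes> \<one> A)"
      by (simp add: on12_def act23_tensor) (simp add: act23_def)
    have "(z' \<otimes> \<one> A) \<cdot> act23 C A s1 \<cdot> on12 C A t3 = act23 C A s1 \<cdot> on12 C A (z' \<otimes> \<one> A) \<cdot> on12 C A t3"
      using chain[OF *, of "on12 C A t3"] by simp
    then show ?thesis
      unfolding mult_z by simp
  qed
  also have "\<dots> = s1 \<cdot> on12 C A (m \<cdot> c') \<cdot> on12 C A (z' \<otimes> \<one> A) \<cdot> on12 C A t3"
    by (simp add: s1_on12_op_mult[symmetric])
  \<comment> \<open>Anti-multiplicativity has produced \<open>S(b a\<^sub>2 S'(a\<^sub>1))c\<close>;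
    by \<open>s'\<close> the inner product is the first antipode component built from
    \<open>t3\<close>, which cancels \<open>t3\<close>.\<close>
  also have "\<dots> = s1 \<cdot> on12 C A (m \<cdot> c' \<cdot> (z' \<otimes> \<one> A)) \<cdot> on12 C A t3"
    by (simp add: fuse)
  also have "\<dots> = (m \<cdot> (z \<otimes> \<one> A)) \<cdot> on12 C A cl"
    unfolding s' mult_z by (simp add: fuse)
  \<comment> \<open>From here on the common value is rewritten as the same expression with the
    identity in place of \<open>z \<cdot> z'\<close>.\<close>
  also have "\<dots> = m \<cdot> on12 C A (s2 \<cdot> t3)"
    unfolding s2_t3 by (simp add: on12_def)
  also have "\<dots> = (m \<cdot> act23 C A s1) \<cdot> on12 C A t3"
    unfolding mult_act23_s1 by (simp add: fuse)
  finally have "m \<cdot> ((z \<cdot> z') \<otimes> \<one> A) \<cdot> act23 C A s1 = m \<cdot> act23 C A s1"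
    by (rule iso_cancel_right[rotated -1]) (simp_all add: iso_on12)
  \<comment> \<open>Composing with \<open>t1\<close> turns \<open>s1\<close> into the counit on the
    middle strand, which is a regular epimorphism and cancels.\<close>
  then have "(m \<cdot> ((z \<cdot> z') \<otimes> \<one> A) \<cdot> act23 C A s1) \<cdot> on23 C A t1 = (m \<cdot> act23 C A s1) \<cdot> on23 C A t1"
    by simp
  then have *: "(m \<cdot> ((z \<cdot> z') \<otimes> \<one> A)) \<cdot> on12 C A cr = m \<cdot> on12 C A cr"
    by (simp add: fuse slide)
  have "m \<cdot> ((z \<cdot> z') \<otimes> \<one> A) = m"
    by (rule regular_epi_cancel[OF regular_epi[OF on12_counit_right_mem] _ _ *]) (simp_all add: hom_def)
  then show "m \<cdot> ((z \<cdot> z') \<otimes> \<one> A) = m \<cdot> (\<one> A \<otimes> \<one> A)"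
    by simp
qed (use z' in \<open>auto simp: hom_def z_simps\<close>)

end

end

text \<open>Only the field \<open>braid\<close> changes, so the axioms of a multiplier bimonoid over
  the inverse braiding can be read in \<open>C\<close>.\<close>

lemma inverse_braided_simps:
  "Ob (inverse_braided C) = Ob C" "unit_ob (inverse_braided C) = unit_ob C"
  "tensor_ob (inverse_braided C) = tensor_ob C"
  "braid (inverse_braided C) = braid_inv C" "comp (inverse_braided C) = comp C"
  "hom (inverse_braided C) = hom C" "on12 (inverse_braided C) = on12 C" "on23 (inverse_braided C) = on23 C"
  "inv_mor (inverse_braided C) = inv_mor C" "counit_left (inverse_braided C) = counit_left C" "counit_right (inverse_braided C) = counit_right C"
  by (simp_all add: inverse_braided_def hom_def on12_def on23_def counit_left_def counit_right_def
      inv_mor_def inverse_pair_def fun_eq_iff)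

section \<open>The two antipodes as mutually inverse morphisms\<close>

theorem theorem3p16:
  fixes C :: "('o, 'm, 'x) braided_data_scheme" (structure)
    and Q :: "'m set" and A :: 'o and t1 t2 t3 t4 e m :: 'm and s s' :: "'m \<times> 'm"
  assumes "braided_monoidal_category C"
    and "regular_epi_class C Q"
    and "regular_multiplier_Hopf_monoid C A t1 t2 t3 t4 e"
    and "m = mult C A t1 e"
    and "nondegenerate C A m"
    and "e \<in> Q"
    and "s = (counit_left C A e \<cdot> minv t1, counit_right C A e \<cdot> minv t2)"
    and "s' = (counit_left C A e \<cdot> minv t3, counit_right C A e \<cdot> minv t4)"
  shows "M_morphism C A A m s \<and>
    M_morphism C A A (op_mult C A m) s' \<and>
    (\<exists>!z. z \<in> hom C A A \<and> s = sharp C A m z) \<and>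
    (\<exists>!z'. z' \<in> hom C A A \<and> s' = sharp C A (op_mult C A m) z') \<and>
    (\<forall>z \<in> hom C A A. \<forall>z' \<in> hom C A A.
      s = sharp C A m z \<and> s' = sharp C A (op_mult C A m) z' \<longrightarrow> inverse_pair C z z')"
proof -
  interpret braided_monoidal_category C by (rule assms(1))
  note hopf = assms(3)[unfolded regular_multiplier_Hopf_monoid_def regular_multiplier_Hopf_monoid_axioms_def
      regular_multiplier_bimonoid_def, folded assms(4)]
  interpret B: multiplier_bimonoid C A t1 t2 e
    using hopf by blast
  interpret B': multiplier_bimonoid "inverse_braided C" A t3 t4 e
    using hopf by blast
  note ob [simp] = B.ob
  have homs: "t3 \<in> hom C (A \<odot> A) (A \<odot> A)" "t4 \<in> hom C (A \<odot> A) (A \<odot> A)"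
    using B'.t1_hom B'.t2_hom by (simp_all only: inverse_braided_simps)
  have [simp]: "e \<in> Ar C" "Dom C e = A" "Cod C e = \<I>" "t3 \<in> Ar C" "Cod C t3 = A \<odot> A" "Dom C t3 = A \<odot> A"
    using B.e_hom homs by auto
  have m: "counit_left C A e \<cdot> t1 = m"
    by (simp only: assms(4) mult_def)
  have t1_t3: "counit_left C A e \<cdot> t1 = counit_left C A e \<cdot> t3 \<cdot> \<c> A A"
    using hopf by blast
  have m_t3: "counit_left C A e \<cdot> t3 = m \<cdot> \<c>' A A"
    unfolding m[symmetric] t1_t3 by simp
  have c: "\<c> A A \<in> hom C (A \<odot> A) (A \<odot> A)" "inverse_pair C (\<c> A A) (\<c>' A A)"
    by (simp_all add: inverse_pair_def hom_def)
  \<comment> \<open>The inverse braiding of the inverse-braided category is the original braiding,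
    so the fusion equation of \<open>t3\<close> acquires the form required by
    \<open>antipode_data\<close>.\<close>
  have cc: "\<c>'\<^bsub>inverse_braided C\<^esub> A A = \<c> A A"
    by (simp add: braid_inv_def[of "inverse_braided C"] inverse_braided_simps)
      (simp add: braid_inv_def inv_mor_inv_mor)
  note B' = B'.fusion1 B'.counit1 B'.counit2 B'.compat B'.mult_eq
  note B' = B'[unfolded inverse_braided_simps cc]
  have isos: "iso C t1" "iso C t2" "iso C t3" "iso C t4"
    and commute: "on12 C A t4 \<cdot> on23 C A t1 = on23 C A t1 \<cdot> on12 C A t4"
      "on23 C A t3 \<cdot> on12 C A t2 = on12 C A t2 \<cdot> on23 C A t3"
    using hopf by blast+
  have counits: "counit_left C A e \<cdot> \<c> A A = counit_right C A e" "counit_right C A e \<cdot> \<c> A A = counit_left C A e"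
    by (simp_all add: counit_braid)
  have nondeg: "nondegenerate C A (m \<cdot> \<c>' A A)"
    using nondegenerate_op_mult[OF assms(5)] by (simp only: op_mult_def)
  interpret X: antipode_data C Q A m "\<c> A A" "\<c>' A A" t1 t2 t3 t4 e
    by (intro antipode_data.intro antipode_data_axioms.intro monoidal_category_axioms assms B.e_hom
        B.t1_hom B.t2_hom ob c homs isos counits B.counit1 B.counit2 B' m B.mult_eq[symmetric, unfolded m] m_t3
        B'(5)[symmetric, unfolded m_t3] B.fusion1 B.compat commute nondeg)
  interpret Y: antipode_data C Q A "m \<cdot> \<c>' A A" "\<c>' A A" "\<c> A A" t3 t4 t1 t2 e
    by (rule X.swap)
  have c_inv: "\<c>' A A \<cdot> \<c> A A = \<one> (A \<odot> A)" by simp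
  have "inverse_pair C z z'"
    if "z \<in> hom C A A" "z' \<in> hom C A A" "s = sharp C A m z" "s' = sharp C A (op_mult C A m) z'" for z z'
  proof -
    have [simp]: "z \<in> Ar C" "Dom C z = A" "Cod C z = A" "z' \<in> Ar C" "Dom C z' = A" "Cod C z' = A"
      using that by auto
    have "m \<cdot> \<c>' A A \<cdot> (z' \<otimes> \<one> A) = counit_left C A e \<cdot> minv t3"
      using that(4) by (simp add: assms(8) sharp_def op_mult_def)
    then have "z \<cdot> z' = \<one> A"
      using X.right_inverse[of z z'] that by (simp add: assms(7))
    \<comment> \<open>For \<open>Y\<close> the multiplication is \<open>m \<cdot> \<c>' A A\<close>
      and the opposite is taken with \<open>\<c> A A\<close>, which returns
      \<open>m\<close>.\<close>
    moreover have "(m \<cdot> \<c>' A A) \<cdot> \<c> A A \<cdot> (z \<otimes> \<one> A) = counit_left C A e \<cdot> minv t1"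
      using that(3) by (simp add: assms(7) sharp_def chain[OF c_inv])
    then have "z' \<cdot> z = \<one> A"
      using Y.right_inverse[of z' z] that by (simp add: assms(8) op_mult_def)
    ultimately show ?thesis
      by (simp add: inverse_pair_def hom_def)
  qed
  then have "\<forall>z \<in> hom C A A. \<forall>z' \<in> hom C A A.
      s = sharp C A m z \<and> s' = sharp C A (op_mult C A m) z' \<longrightarrow> inverse_pair C z z'"
    by (intro ballI impI) (elim conjE)
  with X.M_morphism_antipode Y.M_morphism_antipode X.antipode_factors_unique Y.antipode_factors_unique
  show ?thesis
    unfolding assms(7,8) op_mult_def by (intro conjI)
qed

end
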